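(* Let $(M,\varphi,\xi,\eta,g)$ be a $(2n+1)$-dimensional para-Sasaki-like Riemannian manifold, let $\alpha,\beta$ be constants, and let $\overline{\nabla}$ be the generalized symmetric metric connection on $M$ determined by $\alpha,\beta$. If $(M,\varphi,\xi,\eta,g)$ is para-Einstein-like with constants $(a,b,c)$, then $(M,\varphi,\xi,\eta,g)$ with the connection $\overline{\nabla}$ is also para-Einstein-like, that is, $\overline{\mathrm{Ric}}=\lambda g+\mu\widetilde{g}+\nu\,\eta\otimes\eta$, with constants $(\lambda,\mu,\nu)$ determined by $$\begin{aligned} \lambda&=\beta^2-\beta+(1-2n)\alpha^2+a,\\ \mu&=(2-2n)(\alpha\beta-\alpha)+\alpha+b,\\ \nu&=(2n-1)\alpha^2+(2n-2)\alpha\beta+(1-2n)\alpha+(2n+1)\beta-\beta^2+c. \end{aligned}$$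
   Context: An almost paracontact almost paracomplex Riemannian manifold (apapR manifold) $(M,\varphi,\xi,\eta,g)$ is a differentiable manifold $M$ of dimension $2n+1$ with a $(1,1)$-tensor field $\varphi$, a vector field $\xi$, a $1$-form $\eta$ and a Riemannian metric $g$ such that, for all vector fields $x,y$: $\eta(\xi)=1$, $\varphi^2x=x-\eta(x)\xi$, $\varphi\xi=0$, $g(\varphi x,\varphi y)=g(x,y)-\eta(x)\eta(y)$, $\mathrm{tr}\,\varphi=0$. Consequently $g(x,\xi)=\eta(x)$ and $g(x,\varphi y)=g(\varphi x,y)$. The associated metric is $\widetilde{g}(x,y)=g(x,\varphi y)+\eta(x)\eta(y)$. With $\nabla$ the Levi-Civita connection of $g$, the apapR manifold is called para-Sasaki-like if $(\nabla_x\varphi)y=-g(x,y)\xi-\eta(y)x+2\eta(x)\eta(y)\xi$ for all vector fields $x,y$. The generalized symmetric metric connection determined by $\alpha,\beta$ is $$\overline{\nabla}_xy=\nabla_xy+\alpha\{g(x,y)\xi-\eta(y)x\}+\beta\{g(\varphi x,y)\xi-\eta(y)\varphi x\}.$$ Conventions: $\overline{R}(x,y)z=\overline{\nabla}_x\overline{\nabla}_yz-\overline{\nabla}_y\overline{\nabla}_xz-\overline{\nabla}_{[x,y]}z$, $\overline{R}(x,y,z,w)=g(\overline{R}(x,y)z,w)$, and $\overline{\mathrm{Ric}}(x,y)=\sum_{i=0}^{2n}\overline{R}(e_i,x,y,e_i)$ for an orthonormal basis $\{e_0=\xi,e_1,\ldots,e_{2n}\}$ of the tangent space; likewise $R$ and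 $\mathrm{Ric}$ with $\nabla$. The manifold is para-Einstein-like with constants $(a,b,c)$ if $\mathrm{Ric}=a\,g+b\,\widetilde{g}+c\,\eta\otimes\eta$, where $a,b,c$ are constants. *)

theory Defs
  imports "HOL-Analysis.Analysis" "HOL-Library.Function_Algebras"
begin

section \<open>Pointwise real vector space structure on functions\<close>

instantiation "fun" :: (type, real_vector) real_vector
begin

definition scaleR_fun :: "real \<Rightarrow> ('a \<Rightarrow> 'b) \<Rightarrow> 'a \<Rightarrow> 'b"
  where "scaleR_fun r f = (\<lambda>x. r *\<^sub>R f x)"

instance
  by standard (simp_all add: scaleR_fun_def fun_eq_iff algebra_simps)

end

lemma scaleR_fun_apply [simp]: "(r *\<^sub>R f) x = r *\<^sub>R f x"
  by (simp add: scaleR_fun_def)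


section \<open>Smooth maps between Euclidean spaces\<close>

text \<open>Both notions below are only used for open \<open>S\<close>.\<close>

fun continuously_differentiable_on ::
  "nat \<Rightarrow> 'a::euclidean_space set \<Rightarrow> ('a \<Rightarrow> 'b::real_normed_vector) \<Rightarrow> bool"
where
  "continuously_differentiable_on 0 S f \<longleftrightarrow> continuous_on S f"
| "continuously_differentiable_on (Suc k) S f \<longleftrightarrow>
     (\<forall>x\<in>S. f differentiable (at x)) \<and>
     (\<forall>v. continuously_differentiable_on k S (\<lambda>x. frechet_derivative f (at x) v))"

definition smooth_on :: "'a::euclidean_space set \<Rightarrow> ('a \<Rightarrow> 'b::real_normed_vector) \<Rightarrow> bool"
  where "smooth_on S f \<longleftrightarrow> (\<forall>k. continuously_differentiable_on k S f)"


section \<open>Smooth manifolds\<close>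

text \<open>
  The manifold is the whole type \<open>'m\<close>, modelled on \<open>'e\<close>. A chart is a pair of its domain and its
  coordinate map; values of the coordinate map outside the domain are irrelevant.
\<close>

type_synonym ('m, 'e) chart = "'m set \<times> ('m \<Rightarrow> 'e)"

definition is_chart :: "('m::topological_space, 'e::euclidean_space) chart \<Rightarrow> bool"
  where "is_chart c \<longleftrightarrow> open (fst c) \<and> open (snd c ` fst c) \<and>
    (\<exists>h. homeomorphism (fst c) (snd c ` fst c) (snd c) h)"

definition param :: "('m, 'e) chart \<Rightarrow> 'e \<Rightarrow> 'm"
  where "param c = inv_into (fst c) (snd c)"

definition smooth_atlas ::
  "('m::{t2_space, second_countable_topology}, 'e::euclidean_space) chart set \<Rightarrow> bool"
  where "smooth_atlas A \<longleftrightarrow>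
    (\<forall>c\<in>A. is_chart c) \<and> (\<Union>c\<in>A. fst c) = UNIV \<and>
    (\<forall>c\<in>A. \<forall>d\<in>A. smooth_on (snd c ` (fst c \<inter> fst d)) (snd d \<circ> param c))"

definition charts_at :: "('m, 'e) chart set \<Rightarrow> 'm \<Rightarrow> ('m, 'e) chart set"
  where "charts_at A p = {c \<in> A. p \<in> fst c}"

definition smooth_function ::
  "('m, 'e::euclidean_space) chart set \<Rightarrow> ('m \<Rightarrow> real) \<Rightarrow> bool"
  where "smooth_function A f \<longleftrightarrow> (\<forall>c\<in>A. smooth_on (snd c ` fst c) (f \<circ> param c))"

text \<open>
  A tangent vector at \<open>p\<close> is the family of its components in all charts around \<open>p\<close>, related by
  the Jacobians of the coordinate changes. The components in the other charts are set to \<open>0\<close>, so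
  that the tangent space is a linear subspace of the space of all families, isomorphic to \<open>'e\<close>.
\<close>

type_synonym ('m, 'e) tvec = "('m, 'e) chart \<Rightarrow> 'e"

definition tangent_space ::
  "('m, 'e::euclidean_space) chart set \<Rightarrow> 'm \<Rightarrow> ('m, 'e) tvec set"
  where "tangent_space A p = {v.
    (\<forall>c. c \<notin> charts_at A p \<longrightarrow> v c = 0) \<and>
    (\<forall>c\<in>charts_at A p. \<forall>d\<in>charts_at A p.
       v d = frechet_derivative (snd d \<circ> param c) (at (snd c p)) (v c))}"

definition vector_field ::
  "('m, 'e::euclidean_space) chart set \<Rightarrow> ('m \<Rightarrow> ('m, 'e) tvec) \<Rightarrow> bool"
  where "vector_field A X \<longleftrightarrow>
    (\<forall>p. X p \<in> tangent_space A p) \<and>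
    (\<forall>c\<in>A. smooth_on (snd c ` fst c) (\<lambda>y. X (param c y) c))"

text \<open>\<open>X f\<close>, computed in some chart around the point (all charts give the same value).\<close>

definition dir_deriv ::
  "('m, 'e::euclidean_space) chart set \<Rightarrow> ('m \<Rightarrow> ('m, 'e) tvec) \<Rightarrow> ('m \<Rightarrow> real) \<Rightarrow> 'm \<Rightarrow> real"
  where "dir_deriv A X f p =
    (let c = (SOME c. c \<in> charts_at A p)
     in frechet_derivative (f \<circ> param c) (at (snd c p)) (X p c))"

definition lie_bracket ::
  "('m, 'e::euclidean_space) chart set \<Rightarrow> ('m \<Rightarrow> ('m, 'e) tvec) \<Rightarrow> ('m \<Rightarrow> ('m, 'e) tvec)
    \<Rightarrow> ('m \<Rightarrow> ('m, 'e) tvec)"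
  where "lie_bracket A X Y p = (\<lambda>c. if c \<in> charts_at A p then
      frechet_derivative (\<lambda>y. Y (param c y) c) (at (snd c p)) (X p c)
    - frechet_derivative (\<lambda>y. X (param c y) c) (at (snd c p)) (Y p c) else 0)"


section \<open>Tensor fields and Riemannian metrics\<close>

definition linear_on_subspace ::
  "'a::real_vector set \<Rightarrow> ('a \<Rightarrow> 'b::real_vector) \<Rightarrow> bool"
  where "linear_on_subspace V L \<longleftrightarrow>
    (\<forall>u\<in>V. \<forall>v\<in>V. L (u + v) = L u + L v) \<and> (\<forall>r. \<forall>u\<in>V. L (r *\<^sub>R u) = r *\<^sub>R L u)"

definition one_form ::
  "('m, 'e::euclidean_space) chart set \<Rightarrow> ('m \<Rightarrow> ('m, 'e) tvec \<Rightarrow> real) \<Rightarrow> bool"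
  where "one_form A \<eta> \<longleftrightarrow>
    (\<forall>p. linear_on_subspace (tangent_space A p) (\<eta> p)) \<and>
    (\<forall>X. vector_field A X \<longrightarrow> smooth_function A (\<lambda>p. \<eta> p (X p)))"

definition endomorphism_field ::
  "('m, 'e::euclidean_space) chart set \<Rightarrow> ('m \<Rightarrow> ('m, 'e) tvec \<Rightarrow> ('m, 'e) tvec) \<Rightarrow> bool"
  where "endomorphism_field A \<phi> \<longleftrightarrow>
    (\<forall>p. linear_on_subspace (tangent_space A p) (\<phi> p) \<and>
         (\<forall>u\<in>tangent_space A p. \<phi> p u \<in> tangent_space A p)) \<and>
    (\<forall>X. vector_field A X \<longrightarrow> vector_field A (\<lambda>p. \<phi> p (X p)))"

definition riemannian_metric ::
  "('m, 'e::euclidean_space) chart set \<Rightarrow> ('m \<Rightarrow> ('m, 'e) tvec \<Rightarrow> ('m, 'e) tvec \<Rightarrow> real) \<Rightarrow> bool"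
  where "riemannian_metric A g \<longleftrightarrow>
    (\<forall>p. \<forall>u\<in>tangent_space A p.
       linear_on_subspace (tangent_space A p) (g p u) \<and>
       (\<forall>v\<in>tangent_space A p. g p u v = g p v u) \<and>
       (u \<noteq> 0 \<longrightarrow> g p u u > 0)) \<and>
    (\<forall>X Y. vector_field A X \<longrightarrow> vector_field A Y \<longrightarrow> smooth_function A (\<lambda>p. g p (X p) (Y p)))"

text \<open>Trace of an endomorphism of a finite-dimensional space \<open>V\<close>, in an arbitrary basis of \<open>V\<close>.\<close>

definition trace_on :: "'a::real_vector set \<Rightarrow> ('a \<Rightarrow> 'a) \<Rightarrow> real"
  where "trace_on V L =
    (let B = (SOME B. independent B \<and> span B = V) in \<Sum>b\<in>B. representation B (L b) b)"


section \<open>Connections and curvature\<close>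

text \<open>
  Connections act on global smooth vector fields; their values on other arguments are irrelevant.
\<close>

type_synonym ('m, 'e) connection =
  "('m \<Rightarrow> ('m, 'e) tvec) \<Rightarrow> ('m \<Rightarrow> ('m, 'e) tvec) \<Rightarrow> ('m \<Rightarrow> ('m, 'e) tvec)"

definition affine_connection ::
  "('m, 'e::euclidean_space) chart set \<Rightarrow> ('m, 'e) connection \<Rightarrow> bool"
  where "affine_connection A D \<longleftrightarrow>
    (\<forall>X Y. vector_field A X \<longrightarrow> vector_field A Y \<longrightarrow> vector_field A (D X Y)) \<and>
    (\<forall>X Y Z. vector_field A X \<longrightarrow> vector_field A Y \<longrightarrow> vector_field A Z \<longrightarrow>
       D (X + Y) Z = D X Z + D Y Z \<and> D X (Y + Z) = D X Y + D X Z) \<and>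
    (\<forall>f X Y. smooth_function A f \<longrightarrow> vector_field A X \<longrightarrow> vector_field A Y \<longrightarrow>
       D (\<lambda>p. f p *\<^sub>R X p) Y = (\<lambda>p. f p *\<^sub>R D X Y p) \<and>
       D X (\<lambda>p. f p *\<^sub>R Y p) = (\<lambda>p. dir_deriv A X f p *\<^sub>R Y p + f p *\<^sub>R D X Y p))"

definition levi_civita_connection ::
  "('m, 'e::euclidean_space) chart set \<Rightarrow> ('m \<Rightarrow> ('m, 'e) tvec \<Rightarrow> ('m, 'e) tvec \<Rightarrow> real)
    \<Rightarrow> ('m, 'e) connection \<Rightarrow> bool"
  where "levi_civita_connection A g D \<longleftrightarrow>
    affine_connection A D \<and>
    (\<forall>X Y. vector_field A X \<longrightarrow> vector_field A Y \<longrightarrow> D X Y - D Y X = lie_bracket A X Y) \<and>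
    (\<forall>X Y Z p. vector_field A X \<longrightarrow> vector_field A Y \<longrightarrow> vector_field A Z \<longrightarrow>
       dir_deriv A X (\<lambda>q. g q (Y q) (Z q)) p = g p (D X Y p) (Z p) + g p (Y p) (D X Z p))"

definition curvature ::
  "('m, 'e::euclidean_space) chart set \<Rightarrow> ('m, 'e) connection
    \<Rightarrow> ('m \<Rightarrow> ('m, 'e) tvec) \<Rightarrow> ('m \<Rightarrow> ('m, 'e) tvec) \<Rightarrow> ('m \<Rightarrow> ('m, 'e) tvec)
    \<Rightarrow> ('m \<Rightarrow> ('m, 'e) tvec)"
  where "curvature A D X Y Z = D X (D Y Z) - D Y (D X Z) - D (lie_bracket A X Y) Z"

text \<open>
  The curvature is a tensor, so its value on tangent vectors at \<open>p\<close> is obtained from arbitrary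
  smooth extensions of these vectors to vector fields.
\<close>

definition extension ::
  "('m, 'e::euclidean_space) chart set \<Rightarrow> 'm \<Rightarrow> ('m, 'e) tvec \<Rightarrow> ('m \<Rightarrow> ('m, 'e) tvec)"
  where "extension A p u = (SOME X. vector_field A X \<and> X p = u)"

definition curvature4 ::
  "('m, 'e::euclidean_space) chart set \<Rightarrow> ('m \<Rightarrow> ('m, 'e) tvec \<Rightarrow> ('m, 'e) tvec \<Rightarrow> real)
    \<Rightarrow> ('m, 'e) connection \<Rightarrow> 'm
    \<Rightarrow> ('m, 'e) tvec \<Rightarrow> ('m, 'e) tvec \<Rightarrow> ('m, 'e) tvec \<Rightarrow> ('m, 'e) tvec \<Rightarrow> real"
  where "curvature4 A g D p x y z w =
    g p (curvature A D (extension A p x) (extension A p y) (extension A p z) p) w"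

definition adapted_orthonormal_basis ::
  "('m, 'e::euclidean_space) chart set \<Rightarrow> ('m \<Rightarrow> ('m, 'e) tvec \<Rightarrow> ('m, 'e) tvec \<Rightarrow> real)
    \<Rightarrow> ('m \<Rightarrow> ('m, 'e) tvec) \<Rightarrow> 'm \<Rightarrow> (nat \<Rightarrow> ('m, 'e) tvec) \<Rightarrow> bool"
  where "adapted_orthonormal_basis A g \<xi> p e \<longleftrightarrow>
    e 0 = \<xi> p \<and> span (e ` {..<DIM('e)}) = tangent_space A p \<and>
    (\<forall>i<DIM('e). \<forall>j<DIM('e). g p (e i) (e j) = (if i = j then 1 else 0))"

text \<open>The choice of the basis does not matter, the sum being a trace.\<close>

definition ricci ::
  "('m, 'e::euclidean_space) chart set \<Rightarrow> ('m \<Rightarrow> ('m, 'e) tvec \<Rightarrow> ('m, 'e) tvec \<Rightarrow> real)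
    \<Rightarrow> ('m \<Rightarrow> ('m, 'e) tvec) \<Rightarrow> ('m, 'e) connection
    \<Rightarrow> 'm \<Rightarrow> ('m, 'e) tvec \<Rightarrow> ('m, 'e) tvec \<Rightarrow> real"
  where "ricci A g \<xi> D p x y =
    (let e = (SOME e. adapted_orthonormal_basis A g \<xi> p e)
     in \<Sum>i<DIM('e). curvature4 A g D p (e i) x y (e i))"


section \<open>Almost paracontact almost paracomplex Riemannian manifolds\<close>

definition apapR_manifold ::
  "nat \<Rightarrow> ('m::{t2_space, second_countable_topology}, 'e::euclidean_space) chart set
    \<Rightarrow> ('m \<Rightarrow> ('m, 'e) tvec \<Rightarrow> ('m, 'e) tvec) \<Rightarrow> ('m \<Rightarrow> ('m, 'e) tvec)
    \<Rightarrow> ('m \<Rightarrow> ('m, 'e) tvec \<Rightarrow> real) \<Rightarrow> ('m \<Rightarrow> ('m, 'e) tvec \<Rightarrow> ('m, 'e) tvec \<Rightarrow> real) \<Rightarrow> bool"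
  where "apapR_manifold n A \<phi> \<xi> \<eta> g \<longleftrightarrow>
    smooth_atlas A \<and> DIM('e) = 2 * n + 1 \<and>
    endomorphism_field A \<phi> \<and> vector_field A \<xi> \<and> one_form A \<eta> \<and> riemannian_metric A g \<and>
    (\<forall>p. \<eta> p (\<xi> p) = 1 \<and> \<phi> p (\<xi> p) = 0 \<and> trace_on (tangent_space A p) (\<phi> p) = 0 \<and>
       (\<forall>x\<in>tangent_space A p. \<phi> p (\<phi> p x) = x - \<eta> p x *\<^sub>R \<xi> p) \<and>
       (\<forall>x\<in>tangent_space A p. \<forall>y\<in>tangent_space A p.
          g p (\<phi> p x) (\<phi> p y) = g p x y - \<eta> p x * \<eta> p y))"

definition associated_metric ::
  "('m \<Rightarrow> ('m, 'e) tvec \<Rightarrow> ('m, 'e) tvec) \<Rightarrow> ('m \<Rightarrow> ('m, 'e) tvec \<Rightarrow> real)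
    \<Rightarrow> ('m \<Rightarrow> ('m, 'e) tvec \<Rightarrow> ('m, 'e) tvec \<Rightarrow> real)
    \<Rightarrow> 'm \<Rightarrow> ('m, 'e) tvec \<Rightarrow> ('m, 'e) tvec \<Rightarrow> real"
  where "associated_metric \<phi> \<eta> g p x y = g p x (\<phi> p y) + \<eta> p x * \<eta> p y"

definition cov_deriv_endomorphism ::
  "('m, 'e) connection \<Rightarrow> ('m \<Rightarrow> ('m, 'e) tvec \<Rightarrow> ('m, 'e::euclidean_space) tvec)
    \<Rightarrow> ('m \<Rightarrow> ('m, 'e) tvec) \<Rightarrow> ('m \<Rightarrow> ('m, 'e) tvec) \<Rightarrow> ('m \<Rightarrow> ('m, 'e) tvec)"
  where "cov_deriv_endomorphism D \<phi> X Y p = D X (\<lambda>q. \<phi> q (Y q)) p - \<phi> p (D X Y p)"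

text \<open>In the following definition \<open>D\<close> is meant to be the Levi-Civita connection of \<open>g\<close>.\<close>

definition para_Sasaki_like ::
  "('m, 'e::euclidean_space) chart set
    \<Rightarrow> ('m \<Rightarrow> ('m, 'e) tvec \<Rightarrow> ('m, 'e) tvec) \<Rightarrow> ('m \<Rightarrow> ('m, 'e) tvec)
    \<Rightarrow> ('m \<Rightarrow> ('m, 'e) tvec \<Rightarrow> real) \<Rightarrow> ('m \<Rightarrow> ('m, 'e) tvec \<Rightarrow> ('m, 'e) tvec \<Rightarrow> real)
    \<Rightarrow> ('m, 'e) connection \<Rightarrow> bool"
  where "para_Sasaki_like A \<phi> \<xi> \<eta> g D \<longleftrightarrow>
    (\<forall>X Y p. vector_field A X \<longrightarrow> vector_field A Y \<longrightarrow>
       cov_deriv_endomorphism D \<phi> X Y p =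
         - (g p (X p) (Y p) *\<^sub>R \<xi> p) - \<eta> p (Y p) *\<^sub>R X p
         + (2 * \<eta> p (X p) * \<eta> p (Y p)) *\<^sub>R \<xi> p)"

definition generalized_symmetric_metric_connection ::
  "('m \<Rightarrow> ('m, 'e) tvec \<Rightarrow> ('m, 'e::euclidean_space) tvec) \<Rightarrow> ('m \<Rightarrow> ('m, 'e) tvec)
    \<Rightarrow> ('m \<Rightarrow> ('m, 'e) tvec \<Rightarrow> real) \<Rightarrow> ('m \<Rightarrow> ('m, 'e) tvec \<Rightarrow> ('m, 'e) tvec \<Rightarrow> real)
    \<Rightarrow> ('m, 'e) connection \<Rightarrow> real \<Rightarrow> real \<Rightarrow> ('m, 'e) connection"
  where "generalized_symmetric_metric_connection \<phi> \<xi> \<eta> g D \<alpha> \<beta> X Y p =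
    D X Y p
    + \<alpha> *\<^sub>R (g p (X p) (Y p) *\<^sub>R \<xi> p - \<eta> p (Y p) *\<^sub>R X p)
    + \<beta> *\<^sub>R (g p (\<phi> p (X p)) (Y p) *\<^sub>R \<xi> p - \<eta> p (Y p) *\<^sub>R \<phi> p (X p))"

definition para_Einstein_like ::
  "('m, 'e::euclidean_space) chart set
    \<Rightarrow> ('m \<Rightarrow> ('m, 'e) tvec \<Rightarrow> ('m, 'e) tvec) \<Rightarrow> ('m \<Rightarrow> ('m, 'e) tvec)
    \<Rightarrow> ('m \<Rightarrow> ('m, 'e) tvec \<Rightarrow> real) \<Rightarrow> ('m \<Rightarrow> ('m, 'e) tvec \<Rightarrow> ('m, 'e) tvec \<Rightarrow> real)
    \<Rightarrow> ('m, 'e) connection \<Rightarrow> real \<Rightarrow> real \<Rightarrow> real \<Rightarrow> bool"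
  where "para_Einstein_like A \<phi> \<xi> \<eta> g D a b c \<longleftrightarrow>
    (\<forall>p. \<forall>x\<in>tangent_space A p. \<forall>y\<in>tangent_space A p.
       ricci A g \<xi> D p x y =
         a * g p x y + b * associated_metric \<phi> \<eta> g p x y + c * (\<eta> p x * \<eta> p y))"

end

theory Submission
  imports Defs
begin

text \<open>
  With \<open>L = \<alpha> + \<beta> \<phi>\<close> the connection is \<open>Dbar\<^sub>X Y = D\<^sub>X Y + g(L X, Y) \<xi> - \<eta>(Y) L X\<close>, and the
  para-Sasaki-like condition forces \<open>D\<^sub>X \<xi> = \<phi> X\<close>. Differentiating, all derivatives of \<open>Y\<close> and \<open>Z\<close>
  cancel in \<open>Rbar(X,Y)Z - R(X,Y)Z\<close>, which leaves an algebraic expression in the values of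
  \<open>X\<close>, \<open>Y\<close>, \<open>Z\<close> at the point. Its trace follows from Parseval's identity and \<open>tr \<phi> = 0\<close>.
  Since both Ricci tensors are evaluated with the same basis and the same extensions, the
  tensoriality of the curvature is not needed, but the existence of an adapted orthonormal basis
  and of global smooth extensions of tangent vectors (by bump functions) is.
\<close>

section \<open>Calculus of smooth maps\<close>

text \<open>The cancellation rests on vanishing torsion. As [X,Y] = D_X Y - D_Y X, the derivatives
  of X and Y enter only through D_X(L Y) - D_Y(L X) - L[X,Y] = \<beta>((D_X \<phi>)Y - (D_Y
  \<phi>)X). The para-Sasaki-like formula reduces this to \<beta>(\<eta>(X)Y - \<eta>(Y)X), because
  its two \<xi>-terms are symmetric in X and Y. The quadratic term g(L X, L Y) is symmetric as well
  and drops out. In the final constants all dependence on n comes from the trace 2n + 1 of the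
  identity. The associated metric itself contains \<eta> \<otimes> \<eta>, so its coefficient has to
  be taken back in \<nu>: this is the origin of the terms (2n - 2)\<alpha>\<beta> + (1 -
  2n)\<alpha>, which are -(\<mu> - b). The analysis is forced by the way curvature acts on tangent
  vectors: connections act on global fields only, and \<open>extension\<close> is a choice that says
  nothing until a smooth field through the given vector is known to exist.\<close>

lemma continuously_differentiable_on_cong:
  assumes "continuously_differentiable_on k S f" "open S" "\<And>x. x \<in> S \<Longrightarrow> f x = h x"
  shows "continuously_differentiable_on k S h"
  using assms
proof (induction k arbitrary: f h)
  case 0
  then show ?case using continuous_on_cong[of S S f h] by auto
next
  case (Suc k)
  have d: "(h has_derivative frechet_derivative f (at x)) (at x)" if "x \<in> S" for x
  proof -
    have "(f has_derivative frechet_derivative f (at x)) (at x)"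
      using Suc.prems(1) that by (simp add: frechet_derivative_works)
    then show ?thesis
      using has_derivative_transform_within_open[OF _ \<open>open S\<close> that] Suc.prems(3) by blast
  qed
  have eq: "frechet_derivative f (at x) = frechet_derivative h (at x)" if "x \<in> S" for x
    using frechet_derivative_at[OF d[OF that]] .
  have "continuously_differentiable_on k S (\<lambda>x. frechet_derivative h (at x) v)" for v
  proof (rule Suc.IH)
    show "continuously_differentiable_on k S (\<lambda>x. frechet_derivative f (at x) v)"
      using Suc.prems(1) by simp
  qed (simp_all add: eq Suc.prems(2))
  then show ?case
    using d by (auto simp: differentiable_def)
qed

text \<open>With the next lemma this replaces \<open>frechet_derivative\<close>, a choice, by an
  explicit family \<open>f'\<close>; the closure proofs below are built on this pair.\<close>

lemma continuously_differentiable_on_SucI: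
  assumes "open S"
    and "\<And>x. x \<in> S \<Longrightarrow> (f has_derivative f' x) (at x)"
    and "\<And>v. continuously_differentiable_on k S (\<lambda>x. f' x v)"
  shows "continuously_differentiable_on (Suc k) S f"
proof -
  have "frechet_derivative f (at x) = f' x" if "x \<in> S" for x
    using frechet_derivative_at[OF assms(2)[OF that]] by simp
  then have "continuously_differentiable_on k S (\<lambda>x. frechet_derivative f (at x) v)" for v
    using continuously_differentiable_on_cong[OF assms(3)[of v] assms(1)] by simp
  then show ?thesis
    using assms(2) by (auto simp: differentiable_def)
qed

lemma continuously_differentiable_on_SucE:
  assumes "continuously_differentiable_on (Suc k) S f"
  obtains f' where "\<And>x. x \<in> S \<Longrightarrow> (f has_derivative f' x) (at x)"
    and "\<And>v. continuously_differentiable_on k S (\<lambda>x. f' x v)"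
proof
  show "(f has_derivative frechet_derivative f (at x)) (at x)" if "x \<in> S" for x
    using assms that by (simp add: frechet_derivative_works)
  show "continuously_differentiable_on k S (\<lambda>x. frechet_derivative f (at x) v)" for v
    using assms by simp
qed

lemma continuously_differentiable_on_SucD:
  assumes "continuously_differentiable_on (Suc k) S f"
  shows "continuously_differentiable_on k S f"
  using assms
proof (induction k arbitrary: f)
  case 0
  then show ?case
    by (auto intro!: continuous_at_imp_continuous_on differentiable_imp_continuous_within)
next
  case (Suc k)
  have "\<forall>x\<in>S. f differentiable (at x)"
    and "continuously_differentiable_on k S (\<lambda>x. frechet_derivative f (at x) v)" for v
    using Suc.prems Suc.IH by simp_all
  then show ?case by simp
qed

text \<open>Derivatives are taken at points and not within \<open>S\<close>, so every clause of the
  definition is local. This permits gluing a field from different formulas on overlapping open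
  sets.\<close>

lemma continuously_differentiable_on_local:
  assumes "\<And>x. x \<in> S \<Longrightarrow> \<exists>U. open U \<and> x \<in> U \<and> continuously_differentiable_on k U f"
  shows "continuously_differentiable_on k S f"
  using assms
proof (induction k arbitrary: f)
  case 0
  have "isCont f x" if "x \<in> S" for x
    using 0[OF that] by (auto simp: continuous_on_eq_continuous_at)
  then show ?case by (simp add: continuous_at_imp_continuous_on)
next
  case (Suc k)
  have "f differentiable (at x)" if "x \<in> S" for x
    using Suc.prems[OF that] by auto
  moreover have "continuously_differentiable_on k S (\<lambda>x. frechet_derivative f (at x) v)" for v
    using Suc.prems by (intro Suc.IH) fastforce
  ultimately show ?case by simp
qed

section \<open>Closure of finite-order differentiability under sums, products and
  composition\<close>

lemma continuously_differentiable_on_const: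
  "open S \<Longrightarrow> continuously_differentiable_on k S (\<lambda>x. c)"
proof (induction k arbitrary: c)
  case (Suc k)
  then show ?case
    by (intro continuously_differentiable_on_SucI[where f' = "\<lambda>x v. 0"]) auto
qed simp

lemma continuously_differentiable_on_bounded_linear:
  assumes "bounded_linear L" "open S" "continuously_differentiable_on k S f"
  shows "continuously_differentiable_on k S (\<lambda>x. L (f x))"
  using assms(3)
proof (induction k arbitrary: f)
  case 0
  then show ?case
    using bounded_linear.continuous_on[OF assms(1)] by simp
next
  case (Suc k)
  obtain f' where f': "\<And>x. x \<in> S \<Longrightarrow> (f has_derivative f' x) (at x)"
      "\<And>v. continuously_differentiable_on k S (\<lambda>x. f' x v)"
    using continuously_differentiable_on_SucE[OF Suc.prems] by blast
  then show ?case
    using Suc.IH assms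
    by (intro continuously_differentiable_on_SucI[where f' = "\<lambda>x v. L (f' x v)"])
      (auto intro: bounded_linear.has_derivative)
qed

lemma continuously_differentiable_on_add:
  assumes "open S" "continuously_differentiable_on k S f" "continuously_differentiable_on k S h"
  shows "continuously_differentiable_on k S (\<lambda>x. f x + h x)"
  using assms(2,3)
proof (induction k arbitrary: f h)
  case 0
  then show ?case by (simp add: continuous_on_add)
next
  case (Suc k)
  obtain f' where f': "\<And>x. x \<in> S \<Longrightarrow> (f has_derivative f' x) (at x)"
      "\<And>v. continuously_differentiable_on k S (\<lambda>x. f' x v)"
    using continuously_differentiable_on_SucE[OF Suc.prems(1)] by blast
  obtain h' where h': "\<And>x. x \<in> S \<Longrightarrow> (h has_derivative h' x) (at x)"
      "\<And>v. continuously_differentiable_on k S (\<lambda>x. h' x v)"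
    using continuously_differentiable_on_SucE[OF Suc.prems(2)] by blast
  show ?case
    using Suc.IH assms f' h'
    by (intro continuously_differentiable_on_SucI[where f' = "\<lambda>x v. f' x v + h' x v"])
      (auto intro: has_derivative_add)
qed

lemma continuously_differentiable_on_sum:
  assumes "open S" "finite I" "\<And>i. i \<in> I \<Longrightarrow> continuously_differentiable_on k S (f i)"
  shows "continuously_differentiable_on k S (\<lambda>x. \<Sum>i\<in>I. f i x)"
  using assms(2,3)
  by (induction I rule: finite_induct)
    (auto simp: continuously_differentiable_on_const continuously_differentiable_on_add assms(1))

text \<open>Leibniz rule. Its terms also contain \<open>f\<close> and \<open>h\<close>
  undifferentiated, so both are lowered by one order with
  \<open>continuously_differentiable_on_SucD\<close>.\<close>

lemma continuously_differentiable_on_bounded_bilinear: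
  assumes "bounded_bilinear B" "open S"
    "continuously_differentiable_on k S f" "continuously_differentiable_on k S h"
  shows "continuously_differentiable_on k S (\<lambda>x. B (f x) (h x))"
  using assms(3,4)
proof (induction k arbitrary: f h)
  case 0
  then show ?case using bounded_bilinear.continuous_on[OF assms(1)] by simp
next
  case (Suc k)
  obtain f' where f': "\<And>x. x \<in> S \<Longrightarrow> (f has_derivative f' x) (at x)"
      "\<And>v. continuously_differentiable_on k S (\<lambda>x. f' x v)"
    using continuously_differentiable_on_SucE[OF Suc.prems(1)] by blast
  obtain h' where h': "\<And>x. x \<in> S \<Longrightarrow> (h has_derivative h' x) (at x)"
      "\<And>v. continuously_differentiable_on k S (\<lambda>x. h' x v)"
    using continuously_differentiable_on_SucE[OF Suc.prems(2)] by blast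
  show ?case
    using Suc.IH Suc.prems[THEN continuously_differentiable_on_SucD] assms f' h'
    by (intro continuously_differentiable_on_SucI
        [where f' = "\<lambda>x v. B (f x) (h' x v) + B (f' x v) (h x)"]
        continuously_differentiable_on_add) (auto intro: bounded_bilinear.FDERIV)
qed

text \<open>The chain rule gives \<open>h' (f x) (f' x v)\<close>, whose direction
  \<open>f' x v\<close> moves with \<open>x\<close>, while the induction hypothesis covers
  \<open>h'\<close> only in fixed directions. Expanding the direction over \<open>Basis\<close>
  leaves a finite sum of products of scalar functions with \<open>h' (f x) b\<close>.\<close>

lemma continuously_differentiable_on_compose:
  fixes f :: "'a::euclidean_space \<Rightarrow> 'b::euclidean_space" and h :: "'b \<Rightarrow> 'c::real_normed_vector"
  assumes "open S" "open T" "f ` S \<subseteq> T"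
    "continuously_differentiable_on k S f" "continuously_differentiable_on k T h"
  shows "continuously_differentiable_on k S (\<lambda>x. h (f x))"
  using assms(4,5)
proof (induction k arbitrary: h)
  case 0
  then show ?case using continuous_on_compose2[of T h S f] assms(3) by auto
next
  case (Suc k)
  obtain f' where f': "\<And>x. x \<in> S \<Longrightarrow> (f has_derivative f' x) (at x)"
      "\<And>v. continuously_differentiable_on k S (\<lambda>x. f' x v)"
    using continuously_differentiable_on_SucE[OF Suc.prems(1)] by blast
  obtain h' where h': "\<And>x. x \<in> T \<Longrightarrow> (h has_derivative h' x) (at x)"
      "\<And>v. continuously_differentiable_on k T (\<lambda>x. h' x v)"
    using continuously_differentiable_on_SucE[OF Suc.prems(2)] by blast
  have d: "((\<lambda>x. h (f x)) has_derivative (\<lambda>v. \<Sum>b\<in>Basis. (f' x v \<bullet> b) *\<^sub>R h' (f x) b)) (at x)"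
    if "x \<in> S" for x
  proof -
    have hx: "(h has_derivative h' (f x)) (at (f x))"
      using h'(1) that assms(3) by blast
    interpret bounded_linear "h' (f x)"
      using has_derivative_bounded_linear[OF hx] .
    have rep: "h' (f x) w = (\<Sum>b\<in>Basis. (w \<bullet> b) *\<^sub>R h' (f x) b)" for w
      by (subst euclidean_representation[of w, symmetric]) (simp only: sum scaleR)
    have "h' (f x) \<circ> f' x = (\<lambda>v. \<Sum>b\<in>Basis. (f' x v \<bullet> b) *\<^sub>R h' (f x) b)"
      by (rule ext) (unfold o_apply, rule rep)
    then show ?thesis
      using diff_chain_at[OF f'(1)[OF that] hx] by (simp only: o_def)
  qed
  show ?case
  proof (intro continuously_differentiable_on_SucI[OF \<open>open S\<close> d]
      continuously_differentiable_on_sum continuously_differentiable_on_bounded_bilinear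
        [OF bounded_bilinear_scaleR])
    show "continuously_differentiable_on k S (\<lambda>x. f' x v \<bullet> b)" for v b
      using continuously_differentiable_on_bounded_linear[OF bounded_linear_inner_left] assms f'
      by blast
    show "continuously_differentiable_on k S (\<lambda>x. h' (f x) b)" for b
      using Suc.IH continuously_differentiable_on_SucD[OF Suc.prems(1)] h'(2) by blast
  qed (use assms in auto)
qed

lemma continuously_differentiable_on_id:
  "open S \<Longrightarrow> continuously_differentiable_on k S (\<lambda>x. x)"
proof (cases k)
  case (Suc j)
  assume "open S"
  then show ?thesis
    unfolding Suc
    by (intro continuously_differentiable_on_SucI[where f' = "\<lambda>x v. v"])
      (auto simp: continuously_differentiable_on_const)
qed auto

lemma smooth_on_const: "open S \<Longrightarrow> smooth_on S (\<lambda>x. c)"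
  and smooth_on_id: "open S \<Longrightarrow> smooth_on S (\<lambda>x. x)"
  by (simp_all add: smooth_on_def continuously_differentiable_on_const
      continuously_differentiable_on_id)

lemma smooth_on_add:
  "open S \<Longrightarrow> smooth_on S f \<Longrightarrow> smooth_on S h \<Longrightarrow> smooth_on S (\<lambda>x. f x + h x)"
  by (simp add: smooth_on_def continuously_differentiable_on_add)

lemma smooth_on_bounded_bilinear:
  "bounded_bilinear B \<Longrightarrow> open S \<Longrightarrow> smooth_on S f \<Longrightarrow> smooth_on S h \<Longrightarrow> smooth_on S (\<lambda>x. B (f x) (h x))"
  by (simp add: smooth_on_def continuously_differentiable_on_bounded_bilinear)

lemmas smooth_on_scaleR = smooth_on_bounded_bilinear[OF bounded_bilinear_scaleR]

lemma smooth_on_compose: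
  fixes f :: "'a::euclidean_space \<Rightarrow> 'b::euclidean_space"
  shows "open S \<Longrightarrow> open T \<Longrightarrow> f ` S \<subseteq> T \<Longrightarrow> smooth_on S f \<Longrightarrow> smooth_on T h
    \<Longrightarrow> smooth_on S (\<lambda>x. h (f x))"
  unfolding smooth_on_def using continuously_differentiable_on_compose by blast

lemma smooth_on_cong:
  "smooth_on S f \<Longrightarrow> open S \<Longrightarrow> (\<And>x. x \<in> S \<Longrightarrow> f x = h x) \<Longrightarrow> smooth_on S h"
  unfolding smooth_on_def using continuously_differentiable_on_cong by blast

lemma smooth_on_local:
  assumes "\<And>x. x \<in> S \<Longrightarrow> \<exists>U. open U \<and> x \<in> U \<and> smooth_on U f"
  shows "smooth_on S f"
  unfolding smooth_on_def
proof
  show "continuously_differentiable_on k S f" for k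
    by (rule continuously_differentiable_on_local) (use assms in \<open>auto simp: smooth_on_def\<close>)
qed

lemma smooth_on_differentiable: "smooth_on S f \<Longrightarrow> x \<in> S \<Longrightarrow> f differentiable (at x)"
  unfolding smooth_on_def using continuously_differentiable_on.simps(2) by blast

lemma smooth_on_frechet_derivative:
  "smooth_on S f \<Longrightarrow> smooth_on S (\<lambda>x. frechet_derivative f (at x) v)"
  unfolding smooth_on_def using continuously_differentiable_on.simps(2) by blast

text \<open>Up to linear combinations this family is closed under differentiation, so its smoothness
  reduces to differentiability.\<close>

definition flat_fun :: "nat \<Rightarrow> real \<Rightarrow> real"
  where "flat_fun n t = (if t > 0 then (1 / t) ^ n * exp (- (1 / t)) else 0)"

text \<open>With s = 1/t this says that \<open>exp\<close> outgrows every power; to the left of 0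
  the function vanishes.\<close>

lemma tendsto_flat_fun_0: "(flat_fun n \<longlongrightarrow> 0) (at 0)"
proof -
  have "((\<lambda>s. s ^ n / exp s) \<longlongrightarrow> (0::real)) at_top"
    by (rule tendsto_power_div_exp_0)
  then have "((\<lambda>t. inverse t ^ n / exp (inverse t)) \<longlongrightarrow> (0::real)) (at_right 0)"
    by (rule filterlim_compose[OF _ filterlim_inverse_at_top_right])
  then have "(flat_fun n \<longlongrightarrow> 0) (at_right 0)"
    by (rule Lim_transform_eventually)
      (auto simp: flat_fun_def eventually_at_filter exp_minus divide_simps intro!: always_eventually)
  moreover have "(flat_fun n \<longlongrightarrow> 0) (at_left 0)"
    by (rule Lim_transform_eventually[OF tendsto_const])
      (auto simp: flat_fun_def eventually_at_filter)
  ultimately show ?thesis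
    by (simp add: filterlim_at_split)
qed

lemma has_real_derivative_flat_fun:
  "(flat_fun n has_real_derivative flat_fun (n + 2) t - real n * flat_fun (n + 1) t) (at t)"
proof -
  consider "t > 0" | "t < 0" | "t = 0" by linarith
  then show ?thesis
  proof cases
    case 1
    have "((\<lambda>t. (1 / t) ^ n * exp (- (1 / t))) has_real_derivative
        flat_fun (n + 2) t - real n * flat_fun (n + 1) t) (at t)"
    \<comment> \<open>\<open>DERIV_power\<close> produces the truncated exponent
      \<open>n - Suc 0\<close>, so \<open>n = 0\<close> is treated separately.\<close>
    proof (cases n)
      case 0
      then show ?thesis
        using 1 by (auto intro!: derivative_eq_intros simp: flat_fun_def power2_eq_square field_simps)
    next
      case (Suc m)
      have p: "((\<lambda>t. (1 / t) ^ n) has_real_derivative - (real n * (1 / t) ^ (n + 1))) (at t)"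
      proof -
        have "((\<lambda>t. 1 / t) has_real_derivative - ((1 / t)\<^sup>2)) (at t)"
          using 1 by (auto intro!: derivative_eq_intros simp: power2_eq_square)
        from DERIV_power[OF this, of n] show ?thesis
          by (simp add: Suc power2_eq_square algebra_simps add_divide_distrib)
      qed
      have q: "((\<lambda>t. exp (- (1 / t))) has_real_derivative (1 / t)\<^sup>2 * exp (- (1 / t))) (at t)"
        using 1 by (auto intro!: derivative_eq_intros simp: power2_eq_square field_simps)
      from DERIV_mult[OF p q] show ?thesis
        using 1 by (simp add: flat_fun_def power2_eq_square algebra_simps)
    qed
    then show ?thesis
      by (rule has_field_derivative_transform_within_open[of _ _ _ "{0<..}"])
        (use 1 in \<open>auto simp: flat_fun_def\<close>)
  next
    case 2
    have "(flat_fun n has_real_derivative 0) (at t)"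
      by (rule has_field_derivative_transform_within_open[OF DERIV_const, where S = "{..<0}"])
        (use 2 in \<open>auto simp: flat_fun_def\<close>)
    then show ?thesis using 2 by (simp add: flat_fun_def)
  next
    case 3
    \<comment> \<open>At 0 the difference quotient is \<open>flat_fun (Suc n)\<close>, so the limit
      one exponent higher gives the derivative 0.\<close>
    have "((\<lambda>h. (flat_fun n (0 + h) - flat_fun n 0) / h) \<longlongrightarrow> 0) (at 0)"
      by (rule Lim_transform_eventually[OF tendsto_flat_fun_0[of "Suc n"]])
        (auto simp: flat_fun_def intro!: always_eventually)
    then show ?thesis
      using 3 by (simp add: DERIV_def flat_fun_def)
  qed
qed

lemma smooth_on_flat_fun: "smooth_on UNIV (flat_fun n)"
proof -
  have "continuously_differentiable_on k UNIV (flat_fun n)" for k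
  proof (induction k arbitrary: n)
    case 0
    have "isCont (flat_fun n) t" for t
      using DERIV_isCont has_real_derivative_flat_fun by blast
    then show ?case
      by (simp add: continuous_at_imp_continuous_on)
  next
    case (Suc k)
    show ?case
    proof (rule continuously_differentiable_on_SucI)
      \<comment> \<open>The derivative is phrased with sums and \<open>*\<^sub>R\<close> alone, the
        shape of the closure lemmas.\<close>
      show "(flat_fun n has_derivative
          (\<lambda>v. v *\<^sub>R (flat_fun (n + 2) t + (- real n) *\<^sub>R flat_fun (n + 1) t))) (at t)" for t
        using has_real_derivative_flat_fun[of n t]
        by (simp add: has_field_derivative_def mult_commute_abs)
      show "continuously_differentiable_on k UNIV
          (\<lambda>t. v *\<^sub>R (flat_fun (n + 2) t + (- real n) *\<^sub>R flat_fun (n + 1) t))" for v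
        by (intro continuously_differentiable_on_bounded_linear[OF bounded_linear_scaleR_right]
            continuously_differentiable_on_add Suc.IH open_UNIV)
    qed simp
  qed
  then show ?thesis by (simp add: smooth_on_def)
qed

lemma ex_smooth_bump:
  fixes z :: "'e::euclidean_space"
  assumes "r > 0"
  shows "\<exists>\<rho> :: 'e \<Rightarrow> real. smooth_on UNIV \<rho> \<and> \<rho> z = 1 \<and> (\<forall>y. y \<notin> cball z r \<longrightarrow> \<rho> y = 0)"
proof (intro exI conjI allI impI)
  \<comment> \<open>The squared distance is a polynomial, hence smooth also at \<open>z\<close>;
    after subtraction from the squared radius, \<open>flat_fun 0\<close> is positive exactly inside
    the ball. The prefactor normalises the value at \<open>z\<close>.\<close>
  define \<rho> where "\<rho> y = (1 / flat_fun 0 (r\<^sup>2)) *\<^sub>R flat_fun 0 (r\<^sup>2 + - ((y + - z) \<bullet> (y + - z)))" for y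
  have "smooth_on UNIV (\<lambda>y. r\<^sup>2 + (-1) *\<^sub>R ((y + - z) \<bullet> (y + - z)))"
    by (intro smooth_on_add smooth_on_const smooth_on_scaleR smooth_on_id
        smooth_on_bounded_bilinear[OF bounded_bilinear_inner]) simp_all
  then have "smooth_on UNIV (\<lambda>y. flat_fun 0 (r\<^sup>2 + (-1) *\<^sub>R ((y + - z) \<bullet> (y + - z))))"
    by (rule smooth_on_compose[where T = UNIV, rotated -2])
       (simp_all add: smooth_on_flat_fun)
  then show "smooth_on UNIV \<rho>"
    unfolding \<rho>_def by (intro smooth_on_scaleR smooth_on_const) simp_all
  show "\<rho> z = 1"
    using assms by (simp add: \<rho>_def flat_fun_def)
  fix y assume "y \<notin> cball z r"
  have "r\<^sup>2 < (dist z y)\<^sup>2"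
    using \<open>y \<notin> cball z r\<close> assms by (intro power_strict_mono) auto
  then show "\<rho> y = 0"
    by (simp add: \<rho>_def flat_fun_def dist_norm norm_minus_commute power2_norm_eq_inner)
qed


section \<open>Tangent spaces and vector fields\<close>

text \<open>\<open>is_chart\<close> only provides some inverse \<open>h\<close>; it is identified
  with \<open>param c\<close> on the image, and so its continuity passes to
  \<open>param c\<close>.\<close>

lemma smooth_atlasD:
  assumes "smooth_atlas A" "c \<in> A"
  shows smooth_atlas_open_domain: "open (fst c)"
    and smooth_atlas_open_image: "open (snd c ` fst c)"
    and smooth_atlas_param_coord: "\<And>q. q \<in> fst c \<Longrightarrow> param c (snd c q) = q"
    and smooth_atlas_continuous_param: "continuous_on (snd c ` fst c) (param c)"
proof -
  have *: "is_chart c"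
    using assms by (simp add: smooth_atlas_def)
  then obtain h where h: "homeomorphism (fst c) (snd c ` fst c) (snd c) h"
    by (auto simp: is_chart_def)
  have inj: "inj_on (snd c) (fst c)"
    using h by (metis homeomorphism_apply1 inj_on_inverseI)
  then show param: "param c (snd c q) = q" if "q \<in> fst c" for q
    using that by (simp add: param_def)
  show "open (fst c)" "open (snd c ` fst c)"
    using * by (simp_all add: is_chart_def)
  have "h y = param c y" if "y \<in> snd c ` fst c" for y
    using that param h by (auto simp: homeomorphism_def)
  then show "continuous_on (snd c ` fst c) (param c)"
    using homeomorphism_cont2[OF h] by (simp cong: continuous_on_cong)
qed

lemma smooth_atlas_coord_param:
  assumes "smooth_atlas A" "c \<in> A" "y \<in> snd c ` fst c"
  shows "param c y \<in> fst c" "snd c (param c y) = y"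
  using assms smooth_atlas_param_coord[OF assms(1,2)] by auto

lemma smooth_atlas_open_coord_image:
  assumes "smooth_atlas A" "c \<in> A" "open U"
  shows "open (snd c ` (fst c \<inter> U))"
proof -
  have "snd c ` (fst c \<inter> U) = param c -` U \<inter> snd c ` fst c"
    using smooth_atlas_param_coord[OF assms(1,2)] by force
  then show ?thesis
    using continuous_on_open_vimage[OF smooth_atlas_open_image[OF assms(1,2)]]
      smooth_atlas_continuous_param[OF assms(1,2)] assms(3)
    by metis
qed

lemma smooth_atlas_open_overlap:
  assumes "smooth_atlas A" "c \<in> A" "d \<in> A"
  shows "open (snd c ` (fst c \<inter> fst d))"
  using assms smooth_atlas_open_coord_image smooth_atlas_open_domain by blast

lemma smooth_atlas_transition:
  assumes "smooth_atlas A" "c \<in> A" "d \<in> A"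
  shows "smooth_on (snd c ` (fst c \<inter> fst d)) (snd d \<circ> param c)"
  using assms by (simp add: smooth_atlas_def)

lemma smooth_atlas_charts_at:
  assumes "smooth_atlas A"
  obtains c where "c \<in> charts_at A p"
  using assms by (fastforce simp: smooth_atlas_def charts_at_def)

section \<open>Jacobians of coordinate changes and the dimension of tangent spaces\<close>

definition transition_deriv :: "('m, 'e::euclidean_space) chart \<Rightarrow> ('m, 'e) chart \<Rightarrow> 'm \<Rightarrow> 'e \<Rightarrow> 'e"
  where "transition_deriv c d q = frechet_derivative (snd d \<circ> param c) (at (snd c q))"

lemma has_derivative_transition:
  assumes "smooth_atlas A" "c \<in> charts_at A q" "d \<in> charts_at A q"
  shows "((snd d \<circ> param c) has_derivative transition_deriv c d q) (at (snd c q))"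
proof -
  have "(snd d \<circ> param c) differentiable (at (snd c q))"
    by (rule smooth_on_differentiable[OF smooth_atlas_transition[OF assms(1)]])
      (use assms in \<open>auto simp: charts_at_def\<close>)
  then show ?thesis
    by (simp add: transition_deriv_def frechet_derivative_works)
qed

lemma linear_transition_deriv:
  assumes "smooth_atlas A" "c \<in> charts_at A q" "d \<in> charts_at A q"
  shows "linear (transition_deriv c d q)"
  using has_derivative_linear[OF has_derivative_transition[OF assms]] .

text \<open>Chain rule for the composite of two coordinate changes. It agrees with the direct change
  over the overlap of \<open>c\<close> and \<open>d\<close>, an open neighbourhood, which is enough
  for the derivative.\<close>

lemma transition_deriv_cocycle:
  assumes A: "smooth_atlas A" and c: "c \<in> charts_at A q" and d: "d \<in> charts_at A q"
    and e: "e \<in> charts_at A q"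
  shows "transition_deriv d e q (transition_deriv c d q w) = transition_deriv c e q w"
proof -
  have cA: "c \<in> A" "d \<in> A" "e \<in> A" and q: "q \<in> fst c" "q \<in> fst d" "q \<in> fst e"
    using c d e by (auto simp: charts_at_def)
  have "(snd d \<circ> param c) (snd c q) = snd d q"
    by (simp add: smooth_atlas_param_coord[OF A cA(1) q(1)])
  then have "((snd e \<circ> param d) \<circ> (snd d \<circ> param c) has_derivative
      transition_deriv d e q \<circ> transition_deriv c d q) (at (snd c q))"
    using diff_chain_at[OF has_derivative_transition[OF A c d]] has_derivative_transition[OF A d e]
    by metis
  then have "(snd e \<circ> param c has_derivative
      transition_deriv d e q \<circ> transition_deriv c d q) (at (snd c q))"
  proof (rule has_derivative_transform_within_open)
    show "open (snd c ` (fst c \<inter> fst d))"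
      using smooth_atlas_open_overlap[OF A cA(1,2)] .
  qed (use q smooth_atlas_param_coord[OF A cA(1)] smooth_atlas_param_coord[OF A cA(2)] in auto)
  then show ?thesis
    using has_derivative_unique[OF has_derivative_transition[OF A c e]]
    by (metis comp_apply)
qed

lemma transition_deriv_self:
  assumes A: "smooth_atlas A" and c: "c \<in> charts_at A q"
  shows "transition_deriv c c q w = w"
proof -
  have cA: "c \<in> A" and q: "q \<in> fst c"
    using c by (auto simp: charts_at_def)
  have "(snd c \<circ> param c has_derivative (\<lambda>w. w)) (at (snd c q))"
    by (rule has_derivative_transform_within_open[OF has_derivative_ident
          smooth_atlas_open_image[OF A cA]])
      (use q smooth_atlas_coord_param[OF A cA] in auto)
  then show ?thesis
    using has_derivative_unique[OF has_derivative_transition[OF A c c]] by metis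
qed

text \<open>Inverse of evaluating a tangent vector in the chart \<open>c\<close>; through it each
  tangent space inherits linear structure and dimension from the model space. The value 0 off
  \<open>charts_at A q\<close> follows the normalisation in \<open>tangent_space\<close>.\<close>

definition tangent_of_coord ::
  "('m, 'e::euclidean_space) chart set \<Rightarrow> ('m, 'e) chart \<Rightarrow> 'm \<Rightarrow> 'e \<Rightarrow> ('m, 'e) tvec"
  where "tangent_of_coord A c q w = (\<lambda>d. if d \<in> charts_at A q then transition_deriv c d q w else 0)"

lemma tangent_of_coord_in:
  assumes "smooth_atlas A" "c \<in> charts_at A q"
  shows "tangent_of_coord A c q w \<in> tangent_space A q"
  using transition_deriv_cocycle[OF assms(1,2)]
  by (auto simp: tangent_space_def tangent_of_coord_def transition_deriv_def)

lemma tangent_of_coord_eq: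
  assumes "c \<in> charts_at A q" "v \<in> tangent_space A q"
  shows "tangent_of_coord A c q (v c) = v"
proof
  fix d
  have "v d = transition_deriv c d q (v c)" if "d \<in> charts_at A q"
    using assms that unfolding tangent_space_def transition_deriv_def by blast
  moreover have "v d = 0" if "d \<notin> charts_at A q"
    using assms(2) that unfolding tangent_space_def by blast
  ultimately show "tangent_of_coord A c q (v c) d = v d"
    by (simp add: tangent_of_coord_def)
qed

lemma tangent_of_coord_self:
  assumes "smooth_atlas A" "c \<in> charts_at A q"
  shows "tangent_of_coord A c q w c = w"
  using assms by (simp add: tangent_of_coord_def transition_deriv_self)

lemma linear_tangent_of_coord:
  assumes "smooth_atlas A" "c \<in> charts_at A q"
  shows "linear (tangent_of_coord A c q)"
  using linear_transition_deriv[OF assms]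
  by (intro linearI) (auto simp: tangent_of_coord_def fun_eq_iff linear_add linear_scale)

lemma tangent_space_eq_range:
  assumes "smooth_atlas A" "c \<in> charts_at A q"
  shows "tangent_space A q = range (tangent_of_coord A c q)"
  using tangent_of_coord_in[OF assms] tangent_of_coord_eq[OF assms(2)] by (metis image_subset_iff rangeI subsetI subset_antisym)

lemma subspace_tangent_space:
  assumes "smooth_atlas A"
  shows "subspace (tangent_space A q)"
proof -
  obtain c where c: "c \<in> charts_at A q"
    using smooth_atlas_charts_at[OF assms] .
  show ?thesis
    using linear_subspace_image[OF linear_tangent_of_coord[OF assms c] subspace_UNIV]
    by (simp add: tangent_space_eq_range[OF assms c])
qed

lemma tangent_space_basis:
  fixes A :: "('m::{t2_space, second_countable_topology}, 'e::euclidean_space) chart set"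
  assumes "smooth_atlas A"
  obtains B where "independent B" "span B = tangent_space A q" "finite B" "card B = DIM('e)"
proof -
  obtain c where c: "c \<in> charts_at A q"
    using smooth_atlas_charts_at[OF assms] .
  note lin = linear_tangent_of_coord[OF assms c]
  have inj: "inj (tangent_of_coord A c q)"
    by (metis injI tangent_of_coord_self[OF assms c])
  show thesis
  proof
    show "independent (tangent_of_coord A c q ` Basis)"
      using linear_independent_injective_image[OF lin independent_Basis] inj
      by (simp add: inj_on_subset)
    show "span (tangent_of_coord A c q ` Basis) = tangent_space A q"
      by (simp add: linear_span_image[OF lin] tangent_space_eq_range[OF assms c])
    show "card (tangent_of_coord A c q ` Basis) = DIM('e)"
      using inj by (simp add: card_image inj_on_subset)
  qed simp
qed

text \<open>A field with constant components \<open>u c\<close> in one chart \<open>c\<close> is cut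
  off by a bump function and continued by 0. It is smooth because the domain of \<open>c\<close> and
  the complement of a closed set \<open>K\<close> holding the support are open and cover the
  manifold.\<close>

lemma ex_vector_field_through:
  fixes A :: "('m::{t2_space, second_countable_topology}, 'e::euclidean_space) chart set"
  assumes A: "smooth_atlas A" and u: "u \<in> tangent_space A p"
  shows "\<exists>X. vector_field A X \<and> X p = u"
proof -
  obtain c where c: "c \<in> charts_at A p"
    using smooth_atlas_charts_at[OF A] .
  then have cA: "c \<in> A" and p: "p \<in> fst c"
    by (auto simp: charts_at_def)
  obtain r where r: "r > 0" "cball (snd c p) r \<subseteq> snd c ` fst c"
    using smooth_atlas_open_image[OF A cA] p by (meson image_eqI open_contains_cball)
  obtain \<rho> :: "'e \<Rightarrow> real" where \<rho>: "smooth_on UNIV \<rho>" "\<rho> (snd c p) = 1"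
    "\<And>y. y \<notin> cball (snd c p) r \<Longrightarrow> \<rho> y = 0"
    using ex_smooth_bump[OF r(1)] by blast
  \<comment> \<open>\<open>K\<close> is compact, hence closed by the Hausdorff property. Closedness
    in the whole manifold, and not just in the chart, is what makes the continuation by 0
    smooth.\<close>
  define K where "K = param c ` cball (snd c p) r"
  have "compact K"
    unfolding K_def
    by (rule compact_continuous_image[OF continuous_on_subset[OF
            smooth_atlas_continuous_param[OF A cA] r(2)] compact_cball])
  then have "closed K"
    by (rule compact_imp_closed)
  have outside: "\<rho> (snd c q) = 0" if "q \<in> fst c" "q \<notin> K" for q
    using that \<rho>(3) smooth_atlas_param_coord[OF A cA] unfolding K_def by (metis image_eqI)
  define X where "X q = (if q \<in> fst c then \<rho> (snd c q) *\<^sub>R tangent_of_coord A c q (u c) else 0)" for q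
  have "vector_field A X"
    unfolding vector_field_def
  proof (intro conjI allI ballI)
    show "X q \<in> tangent_space A q" for q
      using subspace_tangent_space[OF A] tangent_of_coord_in[OF A] cA
      by (auto simp: X_def charts_at_def subspace_scale subspace_0)
  next
    fix d assume d: "d \<in> A"
    show "smooth_on (snd d ` fst d) (\<lambda>y. X (param d y) d)"
    proof (rule smooth_on_local)
      fix y assume "y \<in> snd d ` fst d"
      then have q: "param d y \<in> fst d" "snd d (param d y) = y"
        using smooth_atlas_coord_param[OF A d] by auto
      show "\<exists>U. open U \<and> y \<in> U \<and> smooth_on U (\<lambda>y. X (param d y) d)"
      proof (cases "param d y \<in> fst c")
        case True
        let ?U = "snd d ` (fst d \<inter> fst c)"
        have op: "open ?U" "open (snd c ` (fst c \<inter> fst d))"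
          using smooth_atlas_open_overlap[OF A] d cA by auto
        have T: "smooth_on ?U (\<lambda>y. snd c (param d y))"
          using smooth_atlas_transition[OF A d cA] by (simp add: o_def)
        have sub: "(\<lambda>y. snd c (param d y)) ` ?U \<subseteq> snd c ` (fst c \<inter> fst d)"
          using smooth_atlas_param_coord[OF A d] by auto
        \<comment> \<open>In another chart \<open>d\<close> the component is the bump times the
          Jacobian of the change from \<open>c\<close> to \<open>d\<close>, evaluated along the
          change from \<open>d\<close> to \<open>c\<close> and applied to the fixed vector
          \<open>u c\<close>.\<close>
        have "smooth_on ?U (\<lambda>y. \<rho> (snd c (param d y)) *\<^sub>R
            frechet_derivative (snd d \<circ> param c) (at (snd c (param d y))) (u c))"
          using smooth_on_scaleR[OF op(1) smooth_on_compose[OF op(1) open_UNIV subset_UNIV T \<rho>(1)]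
              smooth_on_compose[OF op sub T
                smooth_on_frechet_derivative[OF smooth_atlas_transition[OF A cA d]]]] .
        moreover have "\<rho> (snd c (param d z)) *\<^sub>R
            frechet_derivative (snd d \<circ> param c) (at (snd c (param d z))) (u c) = X (param d z) d"
          if "z \<in> ?U" for z
          using that d smooth_atlas_param_coord[OF A d]
          by (auto simp: X_def tangent_of_coord_def charts_at_def transition_deriv_def)
        ultimately have "smooth_on ?U (\<lambda>y. X (param d y) d)"
          by (rule smooth_on_cong[OF _ op(1)])
        moreover have "y \<in> ?U"
          using q True by (metis IntI image_eqI)
        ultimately show ?thesis
          using op(1) by blast
      next
        case False
        let ?U = "snd d ` (fst d \<inter> - K)"
        have "param d y \<notin> K"
          using False r(2) smooth_atlas_coord_param[OF A cA] by (auto simp: K_def)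
        then have "y \<in> ?U"
          using q by (metis ComplI IntI image_eqI)
        moreover have op: "open ?U"
          using smooth_atlas_open_coord_image[OF A d] \<open>closed K\<close> by blast
        moreover have "smooth_on ?U (\<lambda>y. X (param d y) d)"
          by (rule smooth_on_cong[OF smooth_on_const[OF op, of 0] op])
            (use smooth_atlas_param_coord[OF A d] outside in \<open>auto simp: X_def\<close>)
        ultimately show ?thesis
          by blast
      qed
    qed
  qed
  moreover have "X p = u"
    using p \<rho>(2) tangent_of_coord_eq[OF c u] by (simp add: X_def)
  ultimately show ?thesis by blast
qed

lemma extension_vector_field:
  fixes A :: "('m::{t2_space, second_countable_topology}, 'e::euclidean_space) chart set"
  assumes "smooth_atlas A" "u \<in> tangent_space A p"
  shows "vector_field A (extension A p u)" "extension A p u p = u"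
  using someI_ex[OF ex_vector_field_through[OF assms]] by (simp_all add: extension_def)

section \<open>Vector fields as a module over the smooth functions\<close>

lemma vector_field_tangent: "vector_field A X \<Longrightarrow> X p \<in> tangent_space A p"
  by (simp add: vector_field_def)

lemma vector_field_add:
  assumes A: "smooth_atlas A" and "vector_field A X" "vector_field A Y"
  shows "vector_field A (\<lambda>p. X p + Y p)"
  using assms subspace_add[OF subspace_tangent_space[OF A]]
  by (auto simp: vector_field_def intro!: smooth_on_add smooth_atlas_open_image)

lemma vector_field_scale:
  assumes A: "smooth_atlas A" and "smooth_function A f" "vector_field A X"
  shows "vector_field A (\<lambda>p. f p *\<^sub>R X p)"
  using assms subspace_scale[OF subspace_tangent_space[OF A]]
  by (auto simp: vector_field_def smooth_function_def o_def
      intro!: smooth_on_scaleR smooth_atlas_open_image)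

lemma smooth_function_const:
  assumes "smooth_atlas A"
  shows "smooth_function A (\<lambda>p. r)"
  using assms by (auto simp: smooth_function_def o_def intro!: smooth_on_const smooth_atlas_open_image)

lemma vector_field_scaleR:
  assumes "smooth_atlas A" "vector_field A X"
  shows "vector_field A (\<lambda>p. r *\<^sub>R X p)"
  using vector_field_scale[OF assms(1) smooth_function_const assms(2)] assms(1) by blast

lemma vector_field_minus:
  assumes "smooth_atlas A" "vector_field A X" "vector_field A Y"
  shows "vector_field A (\<lambda>p. X p - Y p)"
  using vector_field_add[OF assms(1,2) vector_field_scaleR[OF assms(1,3), of "-1"]] by simp

lemma dir_deriv_const: "dir_deriv A X (\<lambda>p. r) p = 0"
  by (simp add: dir_deriv_def o_def Let_def)


section \<open>Linear algebra of a tangent space\<close>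

text \<open>Each tangent space is a subspace of the type of all chart-indexed families and varies
  with the point, so the inner product is attached to a set \<open>V\<close> and not to a
  type.\<close>

locale inner_product_on =
  fixes V :: "'a::real_vector set" and G :: "'a \<Rightarrow> 'a \<Rightarrow> real"
  assumes subspace: "subspace V"
    and G_add_right: "\<And>u v w. u \<in> V \<Longrightarrow> v \<in> V \<Longrightarrow> w \<in> V \<Longrightarrow> G u (v + w) = G u v + G u w"
    and G_scaleR_right: "\<And>u v r. u \<in> V \<Longrightarrow> v \<in> V \<Longrightarrow> G u (r *\<^sub>R v) = r * G u v"
    and G_commute: "\<And>u v. u \<in> V \<Longrightarrow> v \<in> V \<Longrightarrow> G u v = G v u"
    and G_pos: "\<And>u. u \<in> V \<Longrightarrow> u \<noteq> 0 \<Longrightarrow> 0 < G u u"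
begin

lemma in_add [simp]: "u \<in> V \<Longrightarrow> v \<in> V \<Longrightarrow> u + v \<in> V"
  and in_diff [simp]: "u \<in> V \<Longrightarrow> v \<in> V \<Longrightarrow> u - v \<in> V"
  and in_scaleR [simp]: "u \<in> V \<Longrightarrow> r *\<^sub>R u \<in> V"
  and in_minus [simp]: "u \<in> V \<Longrightarrow> - u \<in> V"
  and in_zero [simp]: "0 \<in> V"
  using subspace by (simp_all add: subspace_add subspace_diff subspace_scale subspace_neg subspace_0)

lemma in_sum: "(\<And>i. i \<in> I \<Longrightarrow> f i \<in> V) \<Longrightarrow> (\<Sum>i\<in>I. f i) \<in> V"
  by (rule subspace_sum[OF subspace])

lemma G_zero_right [simp]: "u \<in> V \<Longrightarrow> G u 0 = 0"
  using G_scaleR_right[of u 0 0] by simp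

lemma G_minus_right: "u \<in> V \<Longrightarrow> v \<in> V \<Longrightarrow> G u (- v) = - G u v"
  using G_scaleR_right[of u v "-1"] by simp

lemma G_diff_right: "u \<in> V \<Longrightarrow> v \<in> V \<Longrightarrow> w \<in> V \<Longrightarrow> G u (v - w) = G u v - G u w"
  using G_add_right[of u v "- w"] by (simp add: G_minus_right)

lemma G_zero_left [simp]: "u \<in> V \<Longrightarrow> G 0 u = 0"
  using G_commute[of 0 u] by simp

lemma G_add_left: "u \<in> V \<Longrightarrow> v \<in> V \<Longrightarrow> w \<in> V \<Longrightarrow> G (v + w) u = G v u + G w u"
  and G_diff_left: "u \<in> V \<Longrightarrow> v \<in> V \<Longrightarrow> w \<in> V \<Longrightarrow> G (v - w) u = G v u - G w u"
  and G_minus_left: "u \<in> V \<Longrightarrow> v \<in> V \<Longrightarrow> G (- v) u = - G v u"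
  and G_scaleR_left: "u \<in> V \<Longrightarrow> v \<in> V \<Longrightarrow> G (r *\<^sub>R v) u = r * G v u"
  by (simp_all add: G_commute[of _ u] G_add_right G_diff_right G_minus_right G_scaleR_right)

lemmas G_linear = G_add_left G_add_right G_diff_left G_diff_right G_minus_left G_minus_right
  G_scaleR_left G_scaleR_right

lemma G_sum_right:
  "u \<in> V \<Longrightarrow> (\<And>i. i \<in> I \<Longrightarrow> f i \<in> V) \<Longrightarrow> G u (\<Sum>i\<in>I. f i) = (\<Sum>i\<in>I. G u (f i))"
  by (induction I rule: infinite_finite_induct) (simp_all add: G_add_right in_sum)

lemma G_sum_left:
  "u \<in> V \<Longrightarrow> (\<And>i. i \<in> I \<Longrightarrow> f i \<in> V) \<Longrightarrow> G (\<Sum>i\<in>I. f i) u = (\<Sum>i\<in>I. G (f i) u)"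
  by (induction I rule: infinite_finite_induct) (simp_all add: G_add_left in_sum)

definition orthonormal :: "nat \<Rightarrow> (nat \<Rightarrow> 'a) \<Rightarrow> bool"
  where "orthonormal k e \<longleftrightarrow>
    (\<forall>i<k. e i \<in> V) \<and> (\<forall>i<k. \<forall>j<k. G (e i) (e j) = (if i = j then 1 else 0))"

lemma orthonormal_in: "orthonormal k e \<Longrightarrow> i < k \<Longrightarrow> e i \<in> V"
  and orthonormal_G: "orthonormal k e \<Longrightarrow> i < k \<Longrightarrow> j < k \<Longrightarrow> G (e i) (e j) = (if i = j then 1 else 0)"
  by (simp_all add: orthonormal_def)

lemma orthonormal_inj_on:
  assumes "orthonormal k e"
  shows "inj_on e {..<k}"
  using assms unfolding orthonormal_def inj_on_def by (metis lessThan_iff zero_neq_one)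

lemma orthonormal_independent:
  assumes "orthonormal k e"
  shows "independent (e ` {..<k})"
proof (rule independent_if_scalars_zero)
  fix f x
  assume 0: "(\<Sum>x\<in>e ` {..<k}. f x *\<^sub>R x) = 0" and "x \<in> e ` {..<k}"
  then obtain j where j: "j < k" "x = e j" by auto
  have "0 = G (\<Sum>i<k. f (e i) *\<^sub>R e i) (e j)"
    using 0 j orthonormal_in[OF assms] by (simp add: sum.reindex[OF orthonormal_inj_on[OF assms]])
  also have "\<dots> = (\<Sum>i<k. f (e i) * (if i = j then 1 else 0))"
    using j orthonormal_in[OF assms] orthonormal_G[OF assms]
    by (subst G_sum_left) (auto simp: G_scaleR_left)
  also have "\<dots> = f x"
    using j by (simp add: if_distrib cong: if_cong)
  finally show "f x = 0" ..
qed simp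

lemma orthonormal_expansion:
  assumes e: "orthonormal k e" and v: "v \<in> span (e ` {..<k})"
  shows "v = (\<Sum>i<k. G v (e i) *\<^sub>R e i)"
proof -
  \<comment> \<open>Membership in \<open>V\<close> is carried through the induction because
    \<open>G\<close> is linear only on \<open>V\<close>.\<close>
  have "v \<in> V \<and> v = (\<Sum>i<k. G v (e i) *\<^sub>R e i)"
    using v
  proof (induction rule: span_induct_alt)
    case base
    then show ?case using orthonormal_in[OF e] by simp
  next
    case (step r x y)
    then obtain j where j: "j < k" "x = e j" by auto
    have "(\<Sum>i<k. G x (e i) *\<^sub>R e i) = (\<Sum>i<k. if i = j then x else 0)"
      using j orthonormal_G[OF e] by (intro sum.cong) auto
    also have "\<dots> = x" using j by simp
    finally have "x = (\<Sum>i<k. G x (e i) *\<^sub>R e i)" by simp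
    moreover have "x \<in> V" using j orthonormal_in[OF e] by simp
    moreover have "(\<Sum>i<k. G (r *\<^sub>R x + y) (e i) *\<^sub>R e i)
        = r *\<^sub>R (\<Sum>i<k. G x (e i) *\<^sub>R e i) + (\<Sum>i<k. G y (e i) *\<^sub>R e i)"
      using step \<open>x \<in> V\<close> orthonormal_in[OF e]
      by (simp add: G_linear scaleR_sum_right sum.distrib scaleR_add_left)
    ultimately show ?case using step by simp
  qed
  then show ?thesis by simp
qed

text \<open>One Gram-Schmidt step: the residual of \<open>v\<close> is nonzero because
  \<open>v\<close> lies outside the span. Only index \<open>k\<close> is updated, so for positive
  \<open>k\<close> a prescribed \<open>e 0\<close> survives.\<close>

lemma orthonormal_extend:
  assumes e: "orthonormal k e" and v: "v \<in> V" "v \<notin> span (e ` {..<k})"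
  obtains w where "orthonormal (Suc k) (e(k := w))"
proof
  define w where "w = v - (\<Sum>i<k. G v (e i) *\<^sub>R e i)"
  have "(\<Sum>i<k. G v (e i) *\<^sub>R e i) \<in> span (e ` {..<k})"
    by (intro span_sum span_scale span_base) auto
  then have "w \<noteq> 0"
    using v(2) by (auto simp: w_def)
  have w: "w \<in> V"
    unfolding w_def using v(1) orthonormal_in[OF e] by (intro in_diff in_sum) auto
  have orth: "G w (e j) = 0" if "j < k" for j
  proof -
    have "G w (e j) = G v (e j) - G (\<Sum>i<k. G v (e i) *\<^sub>R e i) (e j)"
      unfolding w_def using that v(1) orthonormal_in[OF e] by (intro G_diff_left in_sum) auto
    also have "G (\<Sum>i<k. G v (e i) *\<^sub>R e i) (e j) = (\<Sum>i<k. G v (e i) * (if i = j then 1 else 0))"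
      using that orthonormal_in[OF e] orthonormal_G[OF e]
      by (subst G_sum_left) (auto simp: G_scaleR_left)
    finally have "G w (e j) = G v (e j) - (\<Sum>i<k. G v (e i) * (if i = j then 1 else 0))" .
    then show ?thesis using that by (simp add: if_distrib cong: if_cong)
  qed
  have orth': "G (e j) w = 0" if "j < k" for j
    using orth[OF that] G_commute[OF w orthonormal_in[OF e that]] by simp
  have "G w w > 0" using G_pos[OF w \<open>w \<noteq> 0\<close>] .
  then show "orthonormal (Suc k) (e(k := (1 / sqrt (G w w)) *\<^sub>R w))"
    using e w orth orth' by (auto simp: orthonormal_def less_Suc_eq G_scaleR_left G_scaleR_right)
qed

text \<open>Gram-Schmidt started at \<open>x\<close>. Fewer than \<open>card B\<close> vectors
  cannot span \<open>V\<close>, so a further step is possible; after \<open>card B\<close> vectors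
  it would give too many independent vectors inside \<open>span B\<close>. The induction starts at 1
  in order to fix \<open>e 0 = x\<close>.\<close>

lemma ex_orthonormal_basis:
  assumes B: "independent B" "span B = V" "finite B" and "0 < card B"
    and x: "x \<in> V" "G x x = 1"
  obtains e where "orthonormal (card B) e" "e 0 = x" "span (e ` {..<card B}) = V"
proof -
  have sub: "span (e ` {..<k}) \<subseteq> V" if "orthonormal k e" for k e
    using orthonormal_in[OF that] by (intro span_minimal subspace) auto
  have "\<exists>e. orthonormal k e \<and> e 0 = x" if "0 < k" "k \<le> card B" for k
    using that
  proof (induction k rule: nat_induct_non_zero)
    case 1
    have "orthonormal 1 (\<lambda>_. x)" using x by (simp add: orthonormal_def)
    then show ?case by (intro exI[of _ "\<lambda>_. x"]) simp
  next
    case (Suc k)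
    then obtain e where e: "orthonormal k e" "e 0 = x" by auto
    have "\<not> V \<subseteq> span (e ` {..<k})"
    proof
      assume "V \<subseteq> span (e ` {..<k})"
      then have "B \<subseteq> span (e ` {..<k})"
        using B(2) span_superset by blast
      then have "card B \<le> card (e ` {..<k})"
        using independent_span_bound[OF _ B(1)] by blast
      also have "\<dots> \<le> k"
        using card_image_le[of "{..<k}" e] by simp
      finally show False using Suc.prems by simp
    qed
    then obtain v where "v \<in> V" "v \<notin> span (e ` {..<k})" by blast
    then obtain w where "orthonormal (Suc k) (e(k := w))"
      using orthonormal_extend[OF e(1)] by blast
    then show ?case
      using e(2) Suc.hyps by (intro exI[of _ "e(k := w)"]) (auto simp del: fun_upd_apply simp: fun_upd_other)
  qed
  then obtain e where e: "orthonormal (card B) e" "e 0 = x"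
    using assms(4) by blast
  have "V \<subseteq> span (e ` {..<card B})"
  proof (rule ccontr)
    assume "\<not> ?thesis"
    then obtain v where "v \<in> V" "v \<notin> span (e ` {..<card B})" by blast
    then obtain w where w: "orthonormal (Suc (card B)) (e(card B := w))"
      using orthonormal_extend[OF e(1)] by blast
    let ?S = "(e(card B := w)) ` {..<Suc (card B)}"
    have "?S \<subseteq> span B"
      using orthonormal_in[OF w] B(2) by blast
    then have "card ?S \<le> card B"
      using independent_span_bound[OF B(3) orthonormal_independent[OF w]] by simp
    then show False
      using card_image[OF orthonormal_inj_on[OF w]] by simp
  qed
  with sub[OF e(1)] have "span (e ` {..<card B}) = V" by blast
  with e show thesis using that by blast
qed

lemma orthonormal_parseval:
  assumes e: "orthonormal k e" "span (e ` {..<k}) = V" and u: "u \<in> V" and v: "v \<in> V"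
  shows "(\<Sum>i<k. G (e i) u * G (e i) v) = G u v"
proof -
  have "G u v = G (\<Sum>i<k. G u (e i) *\<^sub>R e i) v"
    using orthonormal_expansion[OF e(1), of u] u e(2) by simp
  also have "\<dots> = (\<Sum>i<k. G (e i) u * G (e i) v)"
    using u v orthonormal_in[OF e(1)]
    by (subst G_sum_left) (auto simp: G_scaleR_left G_commute[of u])
  finally show ?thesis ..
qed

text \<open>\<open>trace_on\<close> works in a chosen basis \<open>B\<close> unrelated to
  \<open>e\<close>. Expanding each \<open>b\<close> in \<open>e\<close> and each
  \<open>L (e i)\<close> in \<open>B\<close>, then exchanging the two sums, moves the trace to
  \<open>e\<close>.\<close>

lemma trace_on_orthonormal:
  assumes e: "orthonormal k e" "span (e ` {..<k}) = V"
    and L_add: "\<And>u v. u \<in> V \<Longrightarrow> v \<in> V \<Longrightarrow> L (u + v) = L u + L v"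
    and L_scaleR: "\<And>u r. u \<in> V \<Longrightarrow> L (r *\<^sub>R u) = r *\<^sub>R L u"
    and L_in: "\<And>u. u \<in> V \<Longrightarrow> L u \<in> V"
  shows "trace_on V L = (\<Sum>i<k. G (e i) (L (e i)))"
proof -
  define B where "B = (SOME B. independent B \<and> span B = V)"
  have "independent B \<and> span B = V"
    unfolding B_def by (rule someI[of _ "e ` {..<k}"]) (use e orthonormal_independent in auto)
  then have B: "independent B" "span B = V" by auto
  have "finite B"
    using independent_span_bound[of "e ` {..<k}" B] B e(2) span_superset[of B] by auto
  have BV: "b \<in> V" if "b \<in> B" for b
    using that B(2) span_base by blast
  have L_sum: "L (\<Sum>i\<in>I. f i) = (\<Sum>i\<in>I. L (f i))" if "\<And>i. i \<in> I \<Longrightarrow> f i \<in> V" for I :: "nat set" and f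
    using that L_scaleR[of 0 0]
    by (induction I rule: infinite_finite_induct) (simp_all add: L_add in_sum)
  have rep: "representation B (L b) b = (\<Sum>i<k. G b (e i) * representation B (L (e i)) b)"
    if "b \<in> B" for b
  proof -
    have "L b = L (\<Sum>i<k. G b (e i) *\<^sub>R e i)"
      using orthonormal_expansion[OF e(1), of b] BV[OF that] e(2) by simp
    also have "\<dots> = (\<Sum>i<k. G b (e i) *\<^sub>R L (e i))"
      using orthonormal_in[OF e(1)] by (subst L_sum) (auto simp: L_scaleR)
    finally show ?thesis
      using orthonormal_in[OF e(1)] L_in B
      by (simp only:) (subst representation_sum, auto simp: representation_scale)
  qed
  have "trace_on V L = (\<Sum>b\<in>B. \<Sum>i<k. G b (e i) * representation B (L (e i)) b)"
    using rep by (simp add: trace_on_def B_def[symmetric] Let_def)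
  also have "\<dots> = (\<Sum>i<k. \<Sum>b\<in>B. G b (e i) * representation B (L (e i)) b)"
    by (rule sum.swap)
  also have "\<dots> = (\<Sum>i<k. G (e i) (L (e i)))"
  proof (rule sum.cong[OF refl])
    fix i assume "i \<in> {..<k}"
    then have ei: "e i \<in> V" using orthonormal_in[OF e(1)] by simp
    have "G (e i) (L (e i)) = G (e i) (\<Sum>b\<in>B. representation B (L (e i)) b *\<^sub>R b)"
      using sum_representation_eq[OF B(1) _ \<open>finite B\<close> order_refl] L_in[OF ei] B(2) by simp
    then show "(\<Sum>b\<in>B. G b (e i) * representation B (L (e i)) b) = G (e i) (L (e i))"
      using ei BV by (simp add: G_sum_right G_scaleR_right G_commute[of _ "e i"] mult.commute)
  qed
  finally show ?thesis .
qed

end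

locale apapR_space = inner_product_on V G
  for V :: "'a::real_vector set" and G :: "'a \<Rightarrow> 'a \<Rightarrow> real" +
  fixes \<phi> :: "'a \<Rightarrow> 'a" and \<xi> :: 'a and \<eta> :: "'a \<Rightarrow> real"
  assumes phi_add: "\<And>u v. u \<in> V \<Longrightarrow> v \<in> V \<Longrightarrow> \<phi> (u + v) = \<phi> u + \<phi> v"
    and phi_scaleR: "\<And>u r. u \<in> V \<Longrightarrow> \<phi> (r *\<^sub>R u) = r *\<^sub>R \<phi> u"
    and phi_in [simp]: "\<And>u. u \<in> V \<Longrightarrow> \<phi> u \<in> V"
    and xi_in [simp]: "\<xi> \<in> V"
    and eta_add: "\<And>u v. u \<in> V \<Longrightarrow> v \<in> V \<Longrightarrow> \<eta> (u + v) = \<eta> u + \<eta> v"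
    and eta_scaleR: "\<And>u r. u \<in> V \<Longrightarrow> \<eta> (r *\<^sub>R u) = r * \<eta> u"
    and eta_xi [simp]: "\<eta> \<xi> = 1"
    and phi_xi [simp]: "\<phi> \<xi> = 0"
    and phi_phi: "\<And>u. u \<in> V \<Longrightarrow> \<phi> (\<phi> u) = u - \<eta> u *\<^sub>R \<xi>"
    and G_phi_phi: "\<And>u v. u \<in> V \<Longrightarrow> v \<in> V \<Longrightarrow> G (\<phi> u) (\<phi> v) = G u v - \<eta> u * \<eta> v"
begin

lemma phi_minus: "u \<in> V \<Longrightarrow> \<phi> (- u) = - \<phi> u"
  using phi_scaleR[of u "-1"] by simp

lemma phi_diff: "u \<in> V \<Longrightarrow> v \<in> V \<Longrightarrow> \<phi> (u - v) = \<phi> u - \<phi> v"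
  using phi_add[of u "- v"] by (simp add: phi_minus)

lemma eta_diff: "u \<in> V \<Longrightarrow> v \<in> V \<Longrightarrow> \<eta> (u - v) = \<eta> u - \<eta> v"
  using eta_add[of u "- v"] eta_scaleR[of v "-1"] by simp

lemma G_xi_right: "u \<in> V \<Longrightarrow> G u \<xi> = \<eta> u"
  using G_phi_phi[of u \<xi>] by simp

lemma G_xi_left: "u \<in> V \<Longrightarrow> G \<xi> u = \<eta> u"
  using G_xi_right[of u] G_commute[of u \<xi>] by simp

text \<open>Computing \<phi>^3 u both as \<phi>^2(\<phi> u) and as \<phi>(\<phi>^2 u) forces
  \<open>\<eta> (\<phi> u) *\<^sub>R \<xi> = 0\<close>.\<close>

lemma eta_phi [simp]: "u \<in> V \<Longrightarrow> \<eta> (\<phi> u) = 0"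
proof -
  assume u: "u \<in> V"
  have "\<phi> u - \<eta> (\<phi> u) *\<^sub>R \<xi> = \<phi> (u - \<eta> u *\<^sub>R \<xi>)"
    using u phi_phi[of u] phi_phi[of "\<phi> u"] by simp
  also have "\<dots> = \<phi> u"
    using u by (simp add: phi_diff phi_scaleR)
  finally have "\<eta> (\<phi> u) *\<^sub>R \<xi> = 0" by simp
  moreover have "\<xi> \<noteq> 0"
    using eta_xi eta_scaleR[of \<xi> 0] by fastforce
  ultimately show ?thesis by simp
qed

text \<open>Compatibility applied to \<open>u\<close> and \<open>\<phi> v\<close>; the correction
  terms vanish because \<open>\<eta>\<close> kills the image of \<open>\<phi>\<close>.\<close>

lemma G_phi_left: "u \<in> V \<Longrightarrow> v \<in> V \<Longrightarrow> G (\<phi> u) v = G u (\<phi> v)"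
  using G_phi_phi[of u "\<phi> v"] by (simp add: phi_phi G_linear G_xi_right)

text \<open>The difference \<open>Rbar(x,y)z - R(x,y)z\<close>, with \<open>D\<^sub>x \<xi> = \<phi> x\<close> and the para-Sasaki-like formula for
  \<open>D \<phi>\<close> already substituted. The first two summands are the terms linear in \<open>\<alpha>\<close> and \<open>\<beta>\<close>.\<close>

definition curvature_diff :: "real \<Rightarrow> real \<Rightarrow> 'a \<Rightarrow> 'a \<Rightarrow> 'a \<Rightarrow> 'a"
  where "curvature_diff \<alpha> \<beta> x y z =
    \<alpha> *\<^sub>R (G y z *\<^sub>R \<phi> x - G x z *\<^sub>R \<phi> y - G z (\<phi> x) *\<^sub>R y + G z (\<phi> y) *\<^sub>R x)
    + \<beta> *\<^sub>R ((\<eta> x * G y z - \<eta> y * G x z) *\<^sub>R \<xi> + (\<eta> z * \<eta> y) *\<^sub>R x - (\<eta> z * \<eta> x) *\<^sub>R y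
        + (2 * G (\<phi> y) z) *\<^sub>R \<phi> x - (2 * G (\<phi> x) z) *\<^sub>R \<phi> y)
    + (let L = (\<lambda>u. \<alpha> *\<^sub>R u + \<beta> *\<^sub>R \<phi> u)
       in (\<alpha> * (\<eta> x * G (L y) z - \<eta> y * G (L x) z)) *\<^sub>R \<xi>
          - (G (L y) z - \<alpha> * \<eta> y * \<eta> z) *\<^sub>R L x + (G (L x) z - \<alpha> * \<eta> x * \<eta> z) *\<^sub>R L y)"

lemma curvature_diff_in:
  "x \<in> V \<Longrightarrow> y \<in> V \<Longrightarrow> z \<in> V \<Longrightarrow> curvature_diff \<alpha> \<beta> x y z \<in> V"
  by (simp add: curvature_diff_def Let_def)

text \<open>Only the first slot is traced. After pairing with \<open>u = e i\<close>, every summand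
  contains \<open>u\<close> twice: paired with itself, paired with \<open>\<phi> u\<close>, or in a
  product of two pairings with fixed vectors. Summation turns these into 2n + 1, 0 and a Parseval
  value.\<close>

lemma trace_curvature_diff:
  assumes e: "orthonormal (2 * n + 1) e" "span (e ` {..<2 * n + 1}) = V"
    and trace: "trace_on V \<phi> = 0" and x: "x \<in> V" and y: "y \<in> V"
  shows "(\<Sum>i<2 * n + 1. G (curvature_diff \<alpha> \<beta> (e i) x y) (e i)) =
    (\<beta>\<^sup>2 - \<beta> + (1 - 2 * real n) * \<alpha>\<^sup>2) * G x y
    + ((2 - 2 * real n) * (\<alpha> * \<beta> - \<alpha>) + \<alpha>) * (G x (\<phi> y) + \<eta> x * \<eta> y)
    + ((2 * real n - 1) * \<alpha>\<^sup>2 + (2 * real n - 2) * \<alpha> * \<beta> + (1 - 2 * real n) * \<alpha>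
      + (2 * real n + 1) * \<beta> - \<beta>\<^sup>2) * (\<eta> x * \<eta> y)"
proof -
  \<comment> \<open>\<open>a\<close> and \<open>b\<close> collect the coefficients of
    \<open>u\<close> and of \<open>\<phi> u\<close> in
    \<open>curvature_diff \<alpha> \<beta> u x y\<close>; \<open>?h\<close> is the value of
    \<open>G\<close> on \<open>\<alpha> *\<^sub>R x + \<beta> *\<^sub>R \<phi> x\<close> and
    \<open>y\<close>.\<close>
  let ?h = "\<alpha> * G x y + \<beta> * G x (\<phi> y)"
  define a where "a = \<alpha> * G x (\<phi> y) + \<beta> * (\<eta> x * \<eta> y) - \<alpha> * (?h - \<alpha> * \<eta> x * \<eta> y)"
  define b where "b = \<alpha> * G x y + 2 * \<beta> * G x (\<phi> y) - \<beta> * (?h - \<alpha> * \<eta> x * \<eta> y)"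
  \<comment> \<open>Each \<open>\<eta> u\<close> is written as \<open>G u \<xi>\<close>, which
    brings the products containing it into Parseval form too.\<close>
  define F where "F u = a * G u u + b * G u (\<phi> u)
      + (\<beta> * G x y + \<alpha> * ?h) * (G u \<xi> * G u \<xi>)
      - (\<beta> + \<alpha>\<^sup>2) * \<eta> x * (G u \<xi> * G u y) - \<alpha> * \<beta> * \<eta> x * (G u \<xi> * G u (\<phi> y))
      - (\<beta> + \<alpha>\<^sup>2) * \<eta> y * (G u \<xi> * G u x) - \<alpha> * \<beta> * \<eta> y * (G u \<xi> * G u (\<phi> x))
      + \<alpha>\<^sup>2 * (G u x * G u y) + (\<beta>\<^sup>2 - 2 * \<beta>) * (G u (\<phi> x) * G u (\<phi> y))
      + (\<alpha> * \<beta> - \<alpha>) * (G u x * G u (\<phi> y)) + (\<alpha> * \<beta> - \<alpha>) * (G u (\<phi> x) * G u y)" for u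
  have ei: "G (curvature_diff \<alpha> \<beta> u x y) u = F u"
    if u: "u \<in> V" for u
    using x y u G_phi_left[of x u] G_phi_left[of y u] G_commute[of "\<phi> x" u] G_commute[of "\<phi> y" u]
    by (simp add: curvature_diff_def Let_def G_linear G_phi_left G_xi_left
        G_xi_right G_commute[of x u] G_commute[of y u] G_commute[of "\<phi> x" u] G_commute[of "\<phi> y" u]
        G_commute[of y "\<phi> x"]
        F_def a_def b_def algebra_simps power2_eq_square)
  note parseval = orthonormal_parseval[OF e]
  have "(\<Sum>i<2 * n + 1. G (e i) (\<phi> (e i))) = 0"
    using trace_on_orthonormal[OF e, of \<phi>] trace by (simp add: phi_add phi_scaleR)
  moreover have "(\<Sum>i<2 * n + 1. G (e i) (e i)) = 2 * real n + 1"
    using orthonormal_G[OF e(1)] by simp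
  moreover have "(\<Sum>i<2 * n + 1. G (curvature_diff \<alpha> \<beta> (e i) x y) (e i)) =
      a * (\<Sum>i<2 * n + 1. G (e i) (e i)) + b * (\<Sum>i<2 * n + 1. G (e i) (\<phi> (e i)))
      + (\<beta> * G x y + \<alpha> * ?h) * G \<xi> \<xi>
      - (\<beta> + \<alpha>\<^sup>2) * \<eta> x * G \<xi> y - \<alpha> * \<beta> * \<eta> x * G \<xi> (\<phi> y)
      - (\<beta> + \<alpha>\<^sup>2) * \<eta> y * G \<xi> x - \<alpha> * \<beta> * \<eta> y * G \<xi> (\<phi> x)
      + \<alpha>\<^sup>2 * G x y + (\<beta>\<^sup>2 - 2 * \<beta>) * G (\<phi> x) (\<phi> y)
      + (\<alpha> * \<beta> - \<alpha>) * G x (\<phi> y) + (\<alpha> * \<beta> - \<alpha>) * G (\<phi> x) y"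
  proof -
    have "(\<Sum>i<2 * n + 1. G (curvature_diff \<alpha> \<beta> (e i) x y) (e i)) = (\<Sum>i<2 * n + 1. F (e i))"
      using orthonormal_in[OF e(1)] by (intro sum.cong ei) auto
    then show ?thesis
      using x y
      by (simp only: F_def sum.distrib sum_subtractf sum_distrib_left[symmetric]
          parseval xi_in phi_in)
  qed
  \<comment> \<open>simp moves every \<open>\<phi>\<close> to the right, so
    \<open>G (\<phi> x) (\<phi> y)\<close> appears in this shape.\<close>
  moreover have "G x (\<phi> (\<phi> y)) = G x y - \<eta> x * \<eta> y"
    using x y G_phi_phi[OF x y] by (simp add: G_phi_left)
  ultimately show ?thesis
    using x y by (simp add: G_xi_left G_phi_left a_def b_def algebra_simps power2_eq_square
        del: sum.lessThan_Suc)
qed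

end


section \<open>Curvature of the generalized symmetric metric connection\<close>

locale para_Sasaki_like_manifold =
  fixes n :: nat
    and A :: "('m::{t2_space, second_countable_topology}, 'e::euclidean_space) chart set"
    and \<phi> :: "'m \<Rightarrow> ('m, 'e) tvec \<Rightarrow> ('m, 'e) tvec"
    and \<xi> :: "'m \<Rightarrow> ('m, 'e) tvec"
    and \<eta> :: "'m \<Rightarrow> ('m, 'e) tvec \<Rightarrow> real"
    and g :: "'m \<Rightarrow> ('m, 'e) tvec \<Rightarrow> ('m, 'e) tvec \<Rightarrow> real"
    and D :: "('m, 'e) connection"
  assumes apapR: "apapR_manifold n A \<phi> \<xi> \<eta> g"
    and levi_civita: "levi_civita_connection A g D"
    and para_Sasaki: "para_Sasaki_like A \<phi> \<xi> \<eta> g D"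
begin

section \<open>The structure at a point and the rules for the Levi-Civita connection\<close>

lemma atlas: "smooth_atlas A"
  and dimension: "DIM('e) = 2 * n + 1"
  and trace_phi: "trace_on (tangent_space A p) (\<phi> p) = 0"
  and xi: "vector_field A \<xi>"
  using apapR by (auto simp: apapR_manifold_def)

lemma apapR_space_at: "apapR_space (tangent_space A p) (g p) (\<phi> p) (\<xi> p) (\<eta> p)"
proof unfold_locales
  show "subspace (tangent_space A p)"
    by (rule subspace_tangent_space[OF atlas])
qed (use apapR vector_field_tangent[OF xi] in \<open>auto simp: apapR_manifold_def riemannian_metric_def
  linear_on_subspace_def endomorphism_field_def one_form_def\<close>)

lemma vector_field_phi: "vector_field A X \<Longrightarrow> vector_field A (\<lambda>p. \<phi> p (X p))"
  using apapR by (auto simp: apapR_manifold_def endomorphism_field_def)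

lemma smooth_metric:
  "vector_field A X \<Longrightarrow> vector_field A Y \<Longrightarrow> smooth_function A (\<lambda>p. g p (X p) (Y p))"
  using apapR by (auto simp: apapR_manifold_def riemannian_metric_def)

lemma smooth_eta: "vector_field A X \<Longrightarrow> smooth_function A (\<lambda>p. \<eta> p (X p))"
  using apapR by (auto simp: apapR_manifold_def one_form_def)

lemma affine: "affine_connection A D"
  using levi_civita by (simp add: levi_civita_connection_def)

lemma vector_field_D: "vector_field A X \<Longrightarrow> vector_field A Y \<Longrightarrow> vector_field A (D X Y)"
  using affine by (simp add: affine_connection_def)

lemma D_add:
  assumes "vector_field A X" "vector_field A Y" "vector_field A Z"
  shows "D X (\<lambda>p. Y p + Z p) q = D X Y q + D X Z q"
proof -
  have "D X (Y + Z) = D X Y + D X Z"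
    using affine assms unfolding affine_connection_def by blast
  then show ?thesis by (simp add: plus_fun_def)
qed

lemma D_scale:
  assumes "smooth_function A f" "vector_field A X" "vector_field A Y"
  shows "D X (\<lambda>p. f p *\<^sub>R Y p) q = dir_deriv A X f q *\<^sub>R Y q + f q *\<^sub>R D X Y q"
proof -
  have "D X (\<lambda>p. f p *\<^sub>R Y p) = (\<lambda>p. dir_deriv A X f p *\<^sub>R Y p + f p *\<^sub>R D X Y p)"
    using affine assms unfolding affine_connection_def by blast
  then show ?thesis by simp
qed

lemma D_scaleR:
  assumes "vector_field A X" "vector_field A Y"
  shows "D X (\<lambda>p. r *\<^sub>R Y p) q = r *\<^sub>R D X Y q"
  using D_scale[OF smooth_function_const[OF atlas] assms] by (simp add: dir_deriv_const)

lemma D_diff: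
  assumes "vector_field A X" "vector_field A Y" "vector_field A Z"
  shows "D X (\<lambda>p. Y p - Z p) q = D X Y q - D X Z q"
  using D_add[OF assms(1,2) vector_field_scaleR[OF atlas assms(3), of "-1"]]
    D_scaleR[OF assms(1,3), of "-1"] by simp

lemma dir_deriv_metric:
  assumes "vector_field A X" "vector_field A Y" "vector_field A Z"
  shows "dir_deriv A X (\<lambda>q. g q (Y q) (Z q)) p = g p (D X Y p) (Z p) + g p (Y p) (D X Z p)"
  using levi_civita assms unfolding levi_civita_connection_def by blast

lemma lie_bracket_eq:
  assumes "vector_field A X" "vector_field A Y"
  shows "lie_bracket A X Y = (\<lambda>p. D X Y p - D Y X p)"
proof -
  have "D X Y - D Y X = lie_bracket A X Y"
    using levi_civita assms unfolding levi_civita_connection_def by blast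
  then show ?thesis by (auto simp: fun_eq_iff)
qed

text \<open>Smoothness of the bracket is read off from vanishing torsion, with no computation in
  coordinates.\<close>

lemma vector_field_lie_bracket:
  "vector_field A X \<Longrightarrow> vector_field A Y \<Longrightarrow> vector_field A (lie_bracket A X Y)"
  by (simp add: lie_bracket_eq vector_field_minus[OF atlas] vector_field_D)

lemma vector_field_curvature:
  assumes "vector_field A X" "vector_field A Y" "vector_field A Z"
  shows "vector_field A (curvature A D X Y Z)"
proof -
  have "curvature A D X Y Z = (\<lambda>p. D X (D Y Z) p - D Y (D X Z) p - D (lie_bracket A X Y) Z p)"
    by (simp add: curvature_def fun_eq_iff)
  then show ?thesis
    using assms by (simp add: vector_field_minus[OF atlas] vector_field_D vector_field_lie_bracket)
qed

lemma D_phi: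
  assumes "vector_field A X" "vector_field A Y"
  shows "D X (\<lambda>q. \<phi> q (Y q)) p = \<phi> p (D X Y p) - g p (X p) (Y p) *\<^sub>R \<xi> p - \<eta> p (Y p) *\<^sub>R X p
    + (2 * \<eta> p (X p) * \<eta> p (Y p)) *\<^sub>R \<xi> p"
proof -
  have "cov_deriv_endomorphism D \<phi> X Y p = - (g p (X p) (Y p) *\<^sub>R \<xi> p) - \<eta> p (Y p) *\<^sub>R X p
         + (2 * \<eta> p (X p) * \<eta> p (Y p)) *\<^sub>R \<xi> p"
    using para_Sasaki assms unfolding para_Sasaki_like_def by blast
  then show ?thesis by (simp add: cov_deriv_endomorphism_def algebra_simps)
qed

text \<open>The para-Sasaki-like formula at Y = \<xi>, where \<phi> \<xi> = 0, gives \<phi>(D_X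
  \<xi>) = X - \<eta>(X) \<xi>. The constant length of \<xi> gives \<eta>(D_X \<xi>) = 0, so
  \<phi>^2 fixes D_X \<xi>, and applying \<phi> to the first identity finishes.\<close>

lemma D_xi:
  assumes X: "vector_field A X"
  shows "D X \<xi> p = \<phi> p (X p)"
proof -
  interpret apapR_space "tangent_space A p" "g p" "\<phi> p" "\<xi> p" "\<eta> p"
    by (rule apapR_space_at)
  have Xp: "X p \<in> tangent_space A p" and Dp: "D X \<xi> p \<in> tangent_space A p"
    using X[THEN vector_field_tangent] vector_field_D[OF X xi, THEN vector_field_tangent] by auto
  \<comment> \<open>The zero field is presented as a multiple of \<open>\<xi>\<close>, so that the
    rule for constant factors shows its derivative to be 0.\<close>
  have "(\<lambda>q. \<phi> q (\<xi> q)) = (\<lambda>q. 0 *\<^sub>R \<xi> q)"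
    using apapR_space.phi_xi[OF apapR_space_at] by simp
  then have "D X (\<lambda>q. \<phi> q (\<xi> q)) p = 0"
    using D_scaleR[OF X xi, of 0] by simp
  moreover have two: "(2 * \<eta> p (X p)) *\<^sub>R \<xi> p = \<eta> p (X p) *\<^sub>R \<xi> p + \<eta> p (X p) *\<^sub>R \<xi> p"
    by (metis mult_2 scaleR_add_left)
  ultimately have phi_D: "\<phi> p (D X \<xi> p) = X p - \<eta> p (X p) *\<^sub>R \<xi> p"
    using D_phi[OF X xi, of p] Xp by (simp add: two G_xi_right algebra_simps)
  have "(\<lambda>q. g q (\<xi> q) (\<xi> q)) = (\<lambda>q. 1)"
    using apapR_space.G_xi_right[OF apapR_space_at] apapR_space.xi_in[OF apapR_space_at]
      apapR_space.eta_xi[OF apapR_space_at] by simp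
  then have "\<eta> p (D X \<xi> p) = 0"
    using dir_deriv_metric[OF X xi xi, of p] Dp by (simp add: dir_deriv_const G_xi_left G_xi_right)
  then have "D X \<xi> p = \<phi> p (\<phi> p (D X \<xi> p))"
    using Dp by (simp add: phi_phi)
  also have "\<dots> = \<phi> p (X p)"
    using Xp by (simp add: phi_D phi_diff phi_scaleR)
  finally show ?thesis .
qed

text \<open>\<eta> is the pairing with \<xi>, so metric compatibility applies; the extra term is
  g(Z, D_X \<xi>).\<close>

lemma dir_deriv_eta:
  assumes "vector_field A X" "vector_field A Z"
  shows "dir_deriv A X (\<lambda>q. \<eta> q (Z q)) p = \<eta> p (D X Z p) + g p (Z p) (\<phi> p (X p))"
proof -
  have "(\<lambda>q. \<eta> q (Z q)) = (\<lambda>q. g q (Z q) (\<xi> q))"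
    using apapR_space.G_xi_right[OF apapR_space_at vector_field_tangent[OF assms(2)]] by simp
  moreover have "g p (D X Z p) (\<xi> p) = \<eta> p (D X Z p)"
    using apapR_space.G_xi_right[OF apapR_space_at vector_field_tangent[OF vector_field_D[OF assms]]] .
  ultimately show ?thesis
    using dir_deriv_metric[OF assms xi, of p] D_xi[OF assms(1)] by simp
qed

section \<open>Curvature of the perturbed connection\<close>

context
  fixes \<alpha> \<beta> :: real
begin

abbreviation Dbar :: "('m, 'e) connection"
  where "Dbar \<equiv> generalized_symmetric_metric_connection \<phi> \<xi> \<eta> g D \<alpha> \<beta>"

abbreviation L :: "('m \<Rightarrow> ('m, 'e) tvec) \<Rightarrow> 'm \<Rightarrow> ('m, 'e) tvec"
  where "L X \<equiv> (\<lambda>p. \<alpha> *\<^sub>R X p + \<beta> *\<^sub>R \<phi> p (X p))"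

lemma vector_field_L: "vector_field A X \<Longrightarrow> vector_field A (L X)"
  by (intro vector_field_add vector_field_scaleR vector_field_phi atlas)

lemma D_L:
  assumes "vector_field A X" "vector_field A Y"
  shows "D X (L Y) p = \<alpha> *\<^sub>R D X Y p + \<beta> *\<^sub>R D X (\<lambda>q. \<phi> q (Y q)) p"
  using assms
  by (simp add: D_add D_scaleR vector_field_scaleR[OF atlas] vector_field_phi)

lemma Dbar_eq:
  assumes "vector_field A X" "vector_field A Y"
  shows "Dbar X Y = (\<lambda>p. D X Y p + g p (L X p) (Y p) *\<^sub>R \<xi> p - \<eta> p (Y p) *\<^sub>R L X p)"
proof
  fix p
  interpret apapR_space "tangent_space A p" "g p" "\<phi> p" "\<xi> p" "\<eta> p"
    by (rule apapR_space_at)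
  show "Dbar X Y p = D X Y p + g p (L X p) (Y p) *\<^sub>R \<xi> p - \<eta> p (Y p) *\<^sub>R L X p"
    using assms[THEN vector_field_tangent, of p]
    by (simp add: generalized_symmetric_metric_connection_def G_add_left G_scaleR_left algebra_simps)
qed

lemma vector_field_Dbar:
  assumes "vector_field A X" "vector_field A Y"
  shows "vector_field A (Dbar X Y)"
  unfolding Dbar_eq[OF assms]
  by (intro vector_field_minus vector_field_add vector_field_scale vector_field_D smooth_metric
      smooth_eta vector_field_L atlas xi assms)

text \<open>Leibniz rule for the three terms of \<open>Dbar_eq\<close>. \<open>D X (L Y)\<close>
  stays unexpanded: it is opened by \<open>D_L\<close> and \<open>D_phi\<close> only in the
  curvature, where it meets its counterpart with \<open>X\<close> and \<open>Y\<close>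
  exchanged.\<close>

lemma D_Dbar:
  assumes X: "vector_field A X" and Y: "vector_field A Y" and Z: "vector_field A Z"
  shows "D X (Dbar Y Z) p = D X (D Y Z) p
    + (g p (D X (L Y) p) (Z p) + g p (L Y p) (D X Z p)) *\<^sub>R \<xi> p
    + g p (L Y p) (Z p) *\<^sub>R \<phi> p (X p)
    - (\<eta> p (D X Z p) + g p (Z p) (\<phi> p (X p))) *\<^sub>R L Y p - \<eta> p (Z p) *\<^sub>R D X (L Y) p"
proof -
  note LY = vector_field_L[OF Y]
  have "D X (Dbar Y Z) p = D X (D Y Z) p + D X (\<lambda>p. g p (L Y p) (Z p) *\<^sub>R \<xi> p) p
      - D X (\<lambda>p. \<eta> p (Z p) *\<^sub>R L Y p) p"
    unfolding Dbar_eq[OF Y Z]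
    by (subst D_diff, (intro vector_field_add vector_field_scale vector_field_D smooth_metric
      smooth_eta LY atlas xi X Y Z)+, subst D_add, (intro vector_field_scale vector_field_D
      smooth_metric LY atlas xi X Y Z)+, rule refl)
  also have "D X (\<lambda>p. g p (L Y p) (Z p) *\<^sub>R \<xi> p) p =
      (g p (D X (L Y) p) (Z p) + g p (L Y p) (D X Z p)) *\<^sub>R \<xi> p + g p (L Y p) (Z p) *\<^sub>R \<phi> p (X p)"
    by (simp only: D_scale[OF smooth_metric[OF LY Z] X xi] dir_deriv_metric[OF X LY Z] D_xi[OF X])
  also have "D X (\<lambda>p. \<eta> p (Z p) *\<^sub>R L Y p) p =
      (\<eta> p (D X Z p) + g p (Z p) (\<phi> p (X p))) *\<^sub>R L Y p + \<eta> p (Z p) *\<^sub>R D X (L Y) p"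
    by (simp only: D_scale[OF smooth_eta[OF Z] X LY] dir_deriv_eta[OF X Z])
  finally show ?thesis by (simp only: add_diff_eq diff_diff_eq add.assoc)
qed

lemma curvature_Dbar:
  assumes X: "vector_field A X" and Y: "vector_field A Y" and Z: "vector_field A Z"
  shows "curvature A Dbar X Y Z p = curvature A D X Y Z p
    + apapR_space.curvature_diff (g p) (\<phi> p) (\<xi> p) (\<eta> p) \<alpha> \<beta> (X p) (Y p) (Z p)"
proof -
  interpret apapR_space "tangent_space A p" "g p" "\<phi> p" "\<xi> p" "\<eta> p"
    by (rule apapR_space_at)
  note in_V = X[THEN vector_field_tangent, of p] Y[THEN vector_field_tangent, of p] Z[THEN vector_field_tangent, of p]
    vector_field_D[OF X Y, THEN vector_field_tangent, of p] vector_field_D[OF Y X, THEN vector_field_tangent, of p]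
    vector_field_D[OF X Z, THEN vector_field_tangent, of p] vector_field_D[OF Y Z, THEN vector_field_tangent, of p]
  have Dbar_Dbar: "Dbar U (Dbar W Z) p = D U (Dbar W Z) p + g p (L U p) (Dbar W Z p) *\<^sub>R \<xi> p
      - \<eta> p (Dbar W Z p) *\<^sub>R L U p" if "vector_field A U" "vector_field A W" for U W
    using Dbar_eq[OF that(1) vector_field_Dbar[OF that(2) Z]] by (rule fun_cong)
  have bracket: "Dbar (lie_bracket A X Y) Z p = D (lie_bracket A X Y) Z p
      + g p (L (lie_bracket A X Y) p) (Z p) *\<^sub>R \<xi> p - \<eta> p (Z p) *\<^sub>R L (lie_bracket A X Y) p"
    using Dbar_eq[OF vector_field_lie_bracket[OF X Y] Z] by (rule fun_cong)
  \<comment> \<open>These equations orient the products left after simp has moved every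
    \<open>\<phi>\<close> to the right. Among other things they let the two orders of g(L X, L Y)
    cancel.\<close>
  have sym: "g p (Y p) (X p) = g p (X p) (Y p)"
    "g p (Y p) (\<phi> p (X p)) = g p (X p) (\<phi> p (Y p))"
    "g p (Z p) (\<phi> p (X p)) = g p (X p) (\<phi> p (Z p))"
    "g p (Z p) (\<phi> p (Y p)) = g p (Y p) (\<phi> p (Z p))"
    "g p (Y p) (\<phi> p (\<phi> p (X p))) = g p (X p) (\<phi> p (\<phi> p (Y p)))"
    using in_V by (metis G_commute G_phi_left phi_in)+
  \<comment> \<open>A factor 2 inside a scalar has to be matched with a sum of two equal
    vectors.\<close>
  have two: "(\<beta> * (2 * t)) *\<^sub>R v = (\<beta> * t) *\<^sub>R v + (\<beta> * t) *\<^sub>R v" for t and v :: "('m, 'e) tvec"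
    by (metis mult_2 distrib_left scaleR_add_left)
  \<comment> \<open>Taking the difference term by term removes the second derivatives, so the
    remaining computation involves first derivatives only.\<close>
  have eq: "curvature A Dbar X Y Z p - curvature A D X Y Z p =
      (Dbar X (Dbar Y Z) p - D X (D Y Z) p) - (Dbar Y (Dbar X Z) p - D Y (D X Z) p)
      - (Dbar (lie_bracket A X Y) Z p - D (lie_bracket A X Y) Z p)"
    by (simp add: curvature_def)
  have "curvature A Dbar X Y Z p - curvature A D X Y Z p = curvature_diff \<alpha> \<beta> (X p) (Y p) (Z p)"
    unfolding eq Dbar_Dbar[OF X Y] Dbar_Dbar[OF Y X] bracket D_Dbar[OF X Y Z] D_Dbar[OF Y X Z]
      D_L[OF X Y] D_L[OF Y X] D_phi[OF X Y] D_phi[OF Y X] fun_cong[OF Dbar_eq[OF X Z], of p]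
      fun_cong[OF Dbar_eq[OF Y Z], of p] fun_cong[OF lie_bracket_eq[OF X Y], of p]
    using in_V sym
    by (simp add: two curvature_diff_def Let_def G_linear G_phi_left G_xi_left G_xi_right phi_add
        phi_diff phi_scaleR eta_add eta_diff eta_scaleR algebra_simps)
  then show ?thesis by (simp add: algebra_simps)
qed

lemma curvature4_Dbar:
  assumes "x \<in> tangent_space A p" "y \<in> tangent_space A p" "z \<in> tangent_space A p"
    "w \<in> tangent_space A p"
  shows "curvature4 A g Dbar p x y z w = curvature4 A g D p x y z w
    + g p (apapR_space.curvature_diff (g p) (\<phi> p) (\<xi> p) (\<eta> p) \<alpha> \<beta> x y z) w"
proof -
  interpret apapR_space "tangent_space A p" "g p" "\<phi> p" "\<xi> p" "\<eta> p"
    by (rule apapR_space_at)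
  note ext = assms(1-3)[THEN extension_vector_field(1)[OF atlas]]
    and ext_at = assms(1-3)[THEN extension_vector_field(2)[OF atlas]]
  show ?thesis
    using assms curvature_Dbar[OF ext, of p]
    by (simp add: curvature4_def ext_at G_add_left curvature_diff_in
        vector_field_tangent[OF vector_field_curvature[OF ext]])
qed

end

section \<open>Passage to the Ricci tensors\<close>

lemma ex_adapted_orthonormal_basis: "\<exists>e. adapted_orthonormal_basis A g \<xi> p e"
proof -
  interpret apapR_space "tangent_space A p" "g p" "\<phi> p" "\<xi> p" "\<eta> p"
    by (rule apapR_space_at)
  obtain B where "independent B" "span B = tangent_space A p" "finite B" "card B = DIM('e)"
    using tangent_space_basis[OF atlas] .
  \<comment> \<open>\<open>\<xi> p\<close> may serve as the first vector because g(\<xi>, \<xi>) =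
    \<eta>(\<xi>) = 1.\<close>
  then obtain e where "orthonormal DIM('e) e" "e 0 = \<xi> p"
    "span (e ` {..<DIM('e)}) = tangent_space A p"
    using ex_orthonormal_basis[of B "\<xi> p"] by (auto simp: G_xi_right)
  then show ?thesis
    by (auto simp: adapted_orthonormal_basis_def orthonormal_def)
qed

lemma ricci_generalized_symmetric_metric_connection:
  assumes x: "x \<in> tangent_space A p" and y: "y \<in> tangent_space A p"
  shows "ricci A g \<xi> (generalized_symmetric_metric_connection \<phi> \<xi> \<eta> g D \<alpha> \<beta>) p x y =
    ricci A g \<xi> D p x y
    + (\<beta>\<^sup>2 - \<beta> + (1 - 2 * real n) * \<alpha>\<^sup>2) * g p x y
    + ((2 - 2 * real n) * (\<alpha> * \<beta> - \<alpha>) + \<alpha>) * associated_metric \<phi> \<eta> g p x y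
    + ((2 * real n - 1) * \<alpha>\<^sup>2 + (2 * real n - 2) * \<alpha> * \<beta> + (1 - 2 * real n) * \<alpha>
      + (2 * real n + 1) * \<beta> - \<beta>\<^sup>2) * (\<eta> p x * \<eta> p y)"
proof -
  interpret apapR_space "tangent_space A p" "g p" "\<phi> p" "\<xi> p" "\<eta> p"
    by (rule apapR_space_at)
  define e where "e = (SOME e. adapted_orthonormal_basis A g \<xi> p e)"
  have "adapted_orthonormal_basis A g \<xi> p e"
    unfolding e_def by (rule someI_ex[OF ex_adapted_orthonormal_basis])
  then have span: "span (e ` {..<2 * n + 1}) = tangent_space A p"
    and G: "\<forall>i<2 * n + 1. \<forall>j<2 * n + 1. g p (e i) (e j) = (if i = j then 1 else 0)"
    by (simp_all add: adapted_orthonormal_basis_def dimension)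
  have e_in: "e i \<in> tangent_space A p" if "i < 2 * n + 1" for i
    unfolding span[symmetric] using that by (intro span_base) simp
  then have e: "orthonormal (2 * n + 1) e"
    using G by (simp add: orthonormal_def)
  have "(\<Sum>i<2 * n + 1. curvature4 A g (generalized_symmetric_metric_connection \<phi> \<xi> \<eta> g D \<alpha> \<beta>)
        p (e i) x y (e i)) =
      (\<Sum>i<2 * n + 1. curvature4 A g D p (e i) x y (e i)
        + g p (curvature_diff \<alpha> \<beta> (e i) x y) (e i))"
    using e_in x y by (intro sum.cong curvature4_Dbar) auto
  then show ?thesis
    by (simp only: ricci_def Let_def e_def[symmetric] dimension sum.distrib associated_metric_def
        trace_curvature_diff[OF e span trace_phi x y] add.assoc)
qed

end

theorem theorem7:
  fixes n :: nat
    and A :: "('m::{t2_space, second_countable_topology}, 'e::euclidean_space) chart set"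
    and \<phi> :: "'m \<Rightarrow> ('m, 'e) tvec \<Rightarrow> ('m, 'e) tvec"
    and \<xi> :: "'m \<Rightarrow> ('m, 'e) tvec"
    and \<eta> :: "'m \<Rightarrow> ('m, 'e) tvec \<Rightarrow> real"
    and g :: "'m \<Rightarrow> ('m, 'e) tvec \<Rightarrow> ('m, 'e) tvec \<Rightarrow> real"
    and nabla :: "('m, 'e) connection"
    and \<alpha> \<beta> a b c :: real
  assumes "apapR_manifold n A \<phi> \<xi> \<eta> g"
    and "levi_civita_connection A g nabla"
    and "para_Sasaki_like A \<phi> \<xi> \<eta> g nabla"
    and "para_Einstein_like A \<phi> \<xi> \<eta> g nabla a b c"
  shows "para_Einstein_like A \<phi> \<xi> \<eta> g
    (generalized_symmetric_metric_connection \<phi> \<xi> \<eta> g nabla \<alpha> \<beta>)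
    (\<beta>\<^sup>2 - \<beta> + (1 - 2 * real n) * \<alpha>\<^sup>2 + a)
    ((2 - 2 * real n) * (\<alpha> * \<beta> - \<alpha>) + \<alpha> + b)
    ((2 * real n - 1) * \<alpha>\<^sup>2 + (2 * real n - 2) * \<alpha> * \<beta> + (1 - 2 * real n) * \<alpha>
      + (2 * real n + 1) * \<beta> - \<beta>\<^sup>2 + c)"
proof -
  interpret para_Sasaki_like_manifold n A \<phi> \<xi> \<eta> g nabla
    using assms(1-3) by unfold_locales
  show ?thesis
    using assms(4)
    by (simp add: para_Einstein_like_def ricci_generalized_symmetric_metric_connection algebra_simps)
qed

end
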